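(* Let $X$ be a finite-dimensional Banach space, let $E$ be a direction set in $X$ of cardinality $2n$, and let $\mathcal{F}$ be a complete, symmetric, simplicial $E$-fan. Then the following statements hold. 1) For every $\alpha\in\mathcal{R}(E)$ and every $c>0$, $c\,\rho(\cdot;\alpha E)=\rho(\cdot;c\alpha E)$. In particular, $\mathcal{N}(E)$ is closed under positive scalar multiplication. 2) The set $\mathcal{N}(\mathcal{F})$ is a cone in $\mathcal{N}(X)$ with respect to pointwise addition and positive scalar multiplication of norms. Moreover, the map $\phi_{\mathcal{F}}:\mathcal{R}(\mathcal{F})\to\mathcal{N}(\mathcal{F})$, $\phi_{\mathcal{F}}(\alpha)=\rho(\cdot;\alpha E)$, is an isomorphism of cones (a bijection preserving addition and positive scalar multiplication); that is, for every $\alpha,\beta\in\mathcal{R}(\mathcal{F})$ and $c>0$, $\rho(\cdot;(\alpha+\beta)E)=\rho(\cdot;\alpha E)+\rho(\cdot;\beta E)$ and $\rho(\cdot;c\alpha E)=c\,\rho(\cdot;\alpha E)$. 3) If $\dim X=2$, then $\mathcal{N}(E)$ is a cone in $\mathcal{N}(X)$, and the map $\phi_E:\mathcal{R}(E)\to\mathcal{N}(E)$, $\phi_E(\alpha)=\rho(\cdot;\alpha E)$, is an isomorphism of cones (a bijection preserving addition and positive scalar multiplication); that is, for every $\alpha,\beta\in\mathcal{R}(E)$ and $c>0$, $\rho(\cdot;(\alpha+\beta)E)=\rho(\cdot;\alpha E)+\rho(\cdot;\beta E)$ and $\rho(\cdot;c\alpha E)=c\,\rho(\cdot;\alpha E)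$.
   Context: $\mathcal{N}(X)$ is the set of equivalent norms on $X$, $B_p=\{x: p(x)\le1\}$, and $d=\dim X$. "Cone" here means a set closed under addition and multiplication by positive scalars (not containing the origin). A direction set in $(X,\|\cdot\|)$ is a finite subset $E\subset S_X$ of the unit sphere with $E=-E$ and $\operatorname{conv}(E)$ having nonempty interior; choosing one representative from each antipodal pair, write $E=\{\pm x_1,\dots,\pm x_n\}$ (cardinality $2n$). $\operatorname{Dir}(E)=\{cx:c>0,x\in E\}$; $\operatorname{Ext}$ denotes the set of extreme points. For $\alpha=(\alpha_1,\dots,\alpha_n)\in\mathbb{R}^n_{>0}$, $\operatorname{conv}(\alpha E)=\operatorname{conv}\{\pm\alpha_1^{-1}x_1,\dots,\pm\alpha_n^{-1}x_n\}$ and $\rho(x;\alpha E)=\inf\{r>0:x\in r\operatorname{conv}(\alpha E)\}$. The multiindex $\alpha$ is $E$-admissible if for every $i$ and every $0<\varepsilon_i<\alpha_i$, with $\alpha'=(\alpha_1,\dots,\alpha_i-\varepsilon_i,\dots,\alpha_n)$, one has $\rho(\cdot;\alpha'E)\ne\rho(\cdot;\alpha E)$. A fan $\mathcal{F}$ in $X$ is a finite collection of polyhedral cones, closed under taking faces, such that the intersection of any two of its cones is a face of both. It is simplicial if every cone is generated by a linearly independent set, complete if its cones cover $X$, symmetric if $-C\in\mathcal{F}$ whenever $C\in\mathcal{F}$, and an $E$-fan if every cone of $\mathcal{F}$ is generated by rays determined by elements of $E$. For a complete, symmetric, simplicial $E$-fan $\mathcal{F}$ and a symmetric weight $\alpha:E\to(0,\infty)$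 (i.e. $\alpha(-x)=\alpha(x)$), the pair $(\mathcal{F},\alpha)$ is $E$-admissible if for every maximal cone $C=\operatorname{cone}(x_{n_1},\dots,x_{n_d})\in\mathcal{F}$ (generators in $E$) the unique $\ell_C^\alpha\in X^*$ with $\ell_C^\alpha(x_{n_k})=\alpha(x_{n_k})$, $k=1,\dots,d$, satisfies $\ell_C^\alpha(x_i)\le\alpha(x_i)$ for every $x_i\in E$. Symmetric weights on $E$ are identified with multiindices via $\alpha\leftrightarrow(\alpha(x_1),\dots,\alpha(x_n))\in\mathbb{R}^n_{>0}$. Definitions of the models: $\mathcal{N}(E)=\{p\in\mathcal{N}(X):\operatorname{Ext}(B_p)\subset\operatorname{Dir}(E)\}$; $\mathcal{R}(E)=\{\alpha\in\mathbb{R}^n_{>0}:\alpha\text{ is }E\text{-admissible}\}$; $\mathcal{N}(\mathcal{F})=\{p\in\mathcal{N}(X): p\text{ is linear on every cone }C\in\mathcal{F}\}$ (linear on $C$ means coinciding on $C$ with a linear functional); $\mathcal{R}(\mathcal{F})=\{\alpha:E\to(0,\infty):\alpha(-x)=\alpha(x)\text{ and }(\mathcal{F},\alpha)\text{ is }E\text{-admissible}\}$.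
   Formalization: In 2), bijectivity of φ_F on R(F) fails if some element of E spans no ray of F; it is stated when every element of E spans a ray of F, and otherwise for φ_F restricted to R(F)∩R(E). Surjectivity onto N(F), additivity and homogeneity hold on all of R(F). *)

theory Defs
  imports "HOL-Analysis.Analysis"
begin

section \<open>Equivalent norms and cones of norms\<close>

definition is_norm :: "('a::real_vector \<Rightarrow> real) \<Rightarrow> bool" where
  "is_norm p \<longleftrightarrow>
     (\<forall>x. 0 \<le> p x) \<and> (\<forall>x. p x = 0 \<longleftrightarrow> x = 0) \<and>
     (\<forall>c x. p (c *\<^sub>R x) = \<bar>c\<bar> * p x) \<and> (\<forall>x y. p (x + y) \<le> p x + p y)"

definition equivalent_norms :: "('a::real_normed_vector \<Rightarrow> real) set" where
  "equivalent_norms =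
     {p. is_norm p \<and> (\<exists>m>0. \<exists>M>0. \<forall>x. m * norm x \<le> p x \<and> p x \<le> M * norm x)}"

definition unit_ball_of :: "('a \<Rightarrow> real) \<Rightarrow> 'a set" where
  "unit_ball_of p = {x. p x \<le> 1}"

text \<open>Cones here are blunt: closed under addition and under multiplication by strictly positive
  scalars, without the origin. The library predicates \<^const>\<open>cone\<close> and \<^const>\<open>conic\<close>
  require closure under multiplication by 0 and are not the right notion.\<close>

definition blunt_cone :: "'v::real_vector set \<Rightarrow> bool" where
  "blunt_cone K \<longleftrightarrow>
     (\<forall>a\<in>K. \<forall>b\<in>K. a + b \<in> K) \<and> (\<forall>a\<in>K. \<forall>c>0. c *\<^sub>R a \<in> K) \<and> 0 \<notin> K"

definition cone_of_norms :: "('a::real_normed_vector \<Rightarrow> real) set \<Rightarrow> bool" where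
  "cone_of_norms K \<longleftrightarrow>
     K \<subseteq> equivalent_norms \<and>
     (\<forall>p\<in>K. \<forall>q\<in>K. (\<lambda>y. p y + q y) \<in> K) \<and>
     (\<forall>p\<in>K. \<forall>c>0. (\<lambda>y. c * p y) \<in> K) \<and>
     (\<lambda>y. 0) \<notin> K"

section \<open>Direction sets\<close>

definition direction_set :: "'a::real_normed_vector set \<Rightarrow> bool" where
  "direction_set E \<longleftrightarrow>
     finite E \<and> E \<subseteq> sphere 0 1 \<and> uminus ` E = E \<and> interior (convex hull E) \<noteq> {}"

text \<open>A choice of one representative from each antipodal pair of a set of cardinality $2n$,
  where $n$ is the cardinality of the index type.\<close>

definition antipodal_representatives :: "('n::finite \<Rightarrow> 'a::real_vector) \<Rightarrow> 'a set \<Rightarrow> bool" where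
  "antipodal_representatives x E \<longleftrightarrow>
     E = range x \<union> range (\<lambda>i. - x i) \<and> card E = 2 * CARD('n)"

definition Dir :: "'a::real_vector set \<Rightarrow> 'a set" where
  "Dir E = {c *\<^sub>R e | c e. c > 0 \<and> e \<in> E}"

definition scaled_hull :: "('n::finite \<Rightarrow> 'a::real_vector) \<Rightarrow> real ^ 'n \<Rightarrow> 'a set" where
  "scaled_hull x \<alpha> =
     convex hull (range (\<lambda>i. inverse (\<alpha> $ i) *\<^sub>R x i) \<union> range (\<lambda>i. - (inverse (\<alpha> $ i) *\<^sub>R x i)))"

definition rho :: "('n::finite \<Rightarrow> 'a::real_vector) \<Rightarrow> real ^ 'n \<Rightarrow> 'a \<Rightarrow> real" where
  "rho x \<alpha> y = Inf {r. r > 0 \<and> y \<in> (\<lambda>z. r *\<^sub>R z) ` scaled_hull x \<alpha>}"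

definition admissible :: "('n::finite \<Rightarrow> 'a::real_vector) \<Rightarrow> real ^ 'n \<Rightarrow> bool" where
  "admissible x \<alpha> \<longleftrightarrow>
     (\<forall>i \<epsilon>. 0 < \<epsilon> \<and> \<epsilon> < \<alpha> $ i \<longrightarrow>
        rho x (\<chi> j. if j = i then \<alpha> $ i - \<epsilon> else \<alpha> $ j) \<noteq> rho x \<alpha>)"

definition N_dir :: "'a::real_normed_vector set \<Rightarrow> ('a \<Rightarrow> real) set" where
  "N_dir E = {p \<in> equivalent_norms. {x. x extreme_point_of unit_ball_of p} \<subseteq> Dir E}"

definition R_dir :: "('n::finite \<Rightarrow> 'a::real_vector) \<Rightarrow> (real ^ 'n) set" where
  "R_dir x = {\<alpha>. (\<forall>i. 0 < \<alpha> $ i) \<and> admissible x \<alpha>}"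

section \<open>Fans\<close>

text \<open>The cone generated by the empty set is the origin, so the zero cone is allowed. The library
  counts the empty set as a face of every convex set, hence its exclusion below.\<close>

definition polyhedral_cone :: "'a::real_vector set \<Rightarrow> bool" where
  "polyhedral_cone C \<longleftrightarrow> (\<exists>S. finite S \<and> C = convex_cone hull S)"

definition fan :: "'a::real_vector set set \<Rightarrow> bool" where
  "fan \<F> \<longleftrightarrow>
     finite \<F> \<and> (\<forall>C\<in>\<F>. polyhedral_cone C) \<and>
     (\<forall>C\<in>\<F>. \<forall>T. T face_of C \<and> T \<noteq> {} \<longrightarrow> T \<in> \<F>) \<and>
     (\<forall>C\<in>\<F>. \<forall>D\<in>\<F>. (C \<inter> D) face_of C \<and> (C \<inter> D) face_of D)"

definition simplicial_fan :: "'a::real_vector set set \<Rightarrow> bool" where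
  "simplicial_fan \<F> \<longleftrightarrow> fan \<F> \<and> (\<forall>C\<in>\<F>. \<exists>S. independent S \<and> C = convex_cone hull S)"

definition complete_fan :: "'a::real_vector set set \<Rightarrow> bool" where
  "complete_fan \<F> \<longleftrightarrow> fan \<F> \<and> \<Union>\<F> = UNIV"

definition symmetric_fan :: "'a::real_vector set set \<Rightarrow> bool" where
  "symmetric_fan \<F> \<longleftrightarrow> fan \<F> \<and> (\<forall>C\<in>\<F>. uminus ` C \<in> \<F>)"

definition E_fan :: "'a::real_vector set \<Rightarrow> 'a set set \<Rightarrow> bool" where
  "E_fan E \<F> \<longleftrightarrow> fan \<F> \<and> (\<forall>C\<in>\<F>. \<exists>S\<subseteq>E. C = convex_cone hull S)"

definition maximal_cone :: "'a::real_vector set set \<Rightarrow> 'a set \<Rightarrow> bool" where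
  "maximal_cone \<F> C \<longleftrightarrow> C \<in> \<F> \<and> (\<forall>D\<in>\<F>. C \<subseteq> D \<longrightarrow> D = C)"

definition symmetric_weight :: "'a::real_vector set \<Rightarrow> ('a \<Rightarrow> real) \<Rightarrow> bool" where
  "symmetric_weight E w \<longleftrightarrow> (\<forall>e\<in>E. 0 < w e \<and> w (- e) = w e)"

text \<open>The set \<open>S\<close> below is a basis, so exactly one functional \<open>l\<close> satisfies the interpolation
  condition and the quantifier over \<open>l\<close> ranges over that functional alone.\<close>

definition fan_admissible :: "'a::real_normed_vector set \<Rightarrow> 'a set set \<Rightarrow> ('a \<Rightarrow> real) \<Rightarrow> bool" where
  "fan_admissible E \<F> w \<longleftrightarrow>
     (\<forall>C S. maximal_cone \<F> C \<and> S \<subseteq> E \<and> independent S \<and> card S = dim (UNIV :: 'a set) \<and>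
            C = convex_cone hull S \<longrightarrow>
        (\<forall>l. bounded_linear l \<and> (\<forall>s\<in>S. l s = w s) \<longrightarrow> (\<forall>e\<in>E. l e \<le> w e)))"

definition N_fan :: "'a::real_normed_vector set set \<Rightarrow> ('a \<Rightarrow> real) set" where
  "N_fan \<F> = {p \<in> equivalent_norms. \<forall>C\<in>\<F>. \<exists>l. linear l \<and> (\<forall>y\<in>C. p y = l y)}"

text \<open>Symmetric weights on \<open>E\<close> are identified with multiindices through their values on the
  chosen representatives, so \<open>R_fan\<close> is a set of multiindices.\<close>

definition multiindex :: "('n::finite \<Rightarrow> 'a) \<Rightarrow> ('a \<Rightarrow> real) \<Rightarrow> real ^ 'n" where
  "multiindex x w = (\<chi> i. w (x i))"

definition R_fan ::
  "'a::real_normed_vector set \<Rightarrow> ('n::finite \<Rightarrow> 'a) \<Rightarrow> 'a set set \<Rightarrow> (real ^ 'n) set" where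
  "R_fan E x \<F> = multiindex x ` {w. symmetric_weight E w \<and> fan_admissible E \<F> w}"

text \<open>\<open>E_fan\<close> does not require every element of \<open>E\<close> to span a ray of the fan; this predicate does.
  If \<open>e \<in> E\<close> spans no cone of the fan, then raising the weight of \<open>\<plusminus>e\<close> preserves admissibility
  of the pair and does not affect \<open>rho\<close>. So \<open>rho\<close> is then not
  injective on a nonempty \<open>R_fan\<close>, although it is on the part of \<open>R_fan\<close> inside \<open>R_dir\<close>.\<close>

definition uses_all_rays :: "'a::real_vector set \<Rightarrow> 'a set set \<Rightarrow> bool" where
  "uses_all_rays E \<F> \<longleftrightarrow> (\<forall>e\<in>E. convex_cone hull {e} \<in> \<F>)"

end

theory Submission
  imports Defs
begin

text \<open>The functional \<^term>\<open>rho x \<alpha>\<close> is the value of a linear programme: the least cost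
  \<open>\<Sum>\<bar>c\<^sub>i\<bar> \<alpha>\<^sub>i\<close> of writing a point as \<open>\<Sum>c\<^sub>i x\<^sub>i\<close> (lemma \<open>rho_attained\<close>). It is
  therefore homogeneous and superadditive in \<open>\<alpha>\<close>, it is the largest norm bounded by the weights on
  the directions, and a multiindex is admissible exactly when its entries are the values of the norm
  on the directions (\<open>R_dir_iff\<close>). Hence \<open>\<alpha> \<mapsto> rho x \<alpha>\<close> is injective on admissible multiindices, and
  additivity in \<open>\<alpha>\<close> only requires that the optimal combinations for \<open>\<alpha>\<close> and \<open>\<beta>\<close> can be chosen
  to use the same directions with the same signs.

  For a fan the common directions are the generators of a full-dimensional cone. Such cones cover
  the space, contain every cone of the fan and are maximal (\<open>chambers_cover\<close>,
  \<open>cone_subset_chamber\<close>, \<open>chamber_maximal\<close>). On each of them an admissible weight gives the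
  interpolating linear functional: convexity bounds the norm above by it, and admissibility bounds
  it above by the norm (\<open>rho_eq_on_chamber\<close>). Conversely a norm that is linear on a full-dimensional
  cone dominates the linear functional everywhere, so its values on the directions form an admissible
  weight, from which it is recovered (\<open>N_fan_is_rho_of_values\<close>).

  In the plane the sectors between adjacent directions play the role of the fan. They cover the plane
  (\<open>adjacent_sectors_cover\<close>), and for any positive weights the norm is linear on them
  (\<open>rho_linear_on_adjacent_sector\<close>), because no direction lies strictly inside such a sector and an
  optimal combination must reach its points from both sides. Surjectivity onto the norms with extreme
  points in the given directions is Minkowski's theorem (\<open>N_dir_is_rho_of_values\<close>).\<close>

section \<open>Cones over finite sets\<close>

lemma convex_cone_hull_finite:
  fixes S :: "'a::real_vector set"
  assumes "finite S"
  shows "convex_cone hull S = {\<Sum>s\<in>S. c s *\<^sub>R s | c. \<forall>s\<in>S. 0 \<le> c s}" (is "_ = ?R")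
proof
  have "convex_cone ?R"
    unfolding convex_cone_iff
  proof (intro conjI allI impI ballI)
    show "0 \<in> ?R"
      by (intro CollectI exI[of _ "\<lambda>_. 0"]) auto
  next
    fix y z assume "y \<in> ?R" "z \<in> ?R"
    then obtain b c where "y = (\<Sum>s\<in>S. b s *\<^sub>R s)" "\<forall>s\<in>S. 0 \<le> b s"
      "z = (\<Sum>s\<in>S. c s *\<^sub>R s)" "\<forall>s\<in>S. 0 \<le> c s" by auto
    then show "y + z \<in> ?R"
      by (intro CollectI exI[of _ "\<lambda>s. b s + c s"]) (auto simp: scaleR_add_left sum.distrib)
  next
    fix y and k :: real assume "y \<in> ?R" "0 \<le> k"
    then obtain b where "y = (\<Sum>s\<in>S. b s *\<^sub>R s)" "\<forall>s\<in>S. 0 \<le> b s" by auto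
    with \<open>0 \<le> k\<close> show "k *\<^sub>R y \<in> ?R"
      by (intro CollectI exI[of _ "\<lambda>s. k * b s"]) (auto simp: scaleR_sum_right)
  qed
  moreover have "S \<subseteq> ?R"
  proof
    fix s assume "s \<in> S"
    have "(\<Sum>t\<in>S. (if t = s then 1 else 0) *\<^sub>R t) = (\<Sum>t\<in>S. if t = s then t else 0)"
      by (rule sum.cong) auto
    also have "\<dots> = s" using assms \<open>s \<in> S\<close> by simp
    finally show "s \<in> ?R"
      by (intro CollectI exI[of _ "\<lambda>t. if t = s then 1 else 0"]) auto
  qed
  ultimately show "convex_cone hull S \<subseteq> ?R"
    by (rule hull_minimal[rotated])
next
  show "?R \<subseteq> convex_cone hull S"
  proof clarify
    fix c :: "'a \<Rightarrow> real" assume c: "\<forall>s\<in>S. 0 \<le> c s"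
    have "T \<subseteq> S \<Longrightarrow> (\<Sum>s\<in>T. c s *\<^sub>R s) \<in> convex_cone hull S" if "finite T" for T
      using that
    proof induction
      case empty
      then show ?case by (simp add: convex_cone_hull_contains_0)
    next
      case (insert s T)
      then show ?case
        using c by (simp add: convex_cone_hull_add convex_cone_hull_mul hull_inc)
    qed
    then show "(\<Sum>s\<in>S. c s *\<^sub>R s) \<in> convex_cone hull S"
      using assms by blast
  qed
qed

lemma convex_cone_hull_subset_span:
  fixes S :: "'a::real_vector set"
  shows "convex_cone hull S \<subseteq> span S"
  by (rule hull_minimal[OF span_superset])
     (auto simp: convex_cone_iff span_0 span_add span_mul)

lemma mem_cone_hull_iff_representation:
  fixes S :: "'a::real_vector set"
  assumes "finite S" "independent S" "y \<in> span S"
  shows "y \<in> convex_cone hull S \<longleftrightarrow> (\<forall>s\<in>S. 0 \<le> representation S y s)"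
proof
  assume "y \<in> convex_cone hull S"
  then obtain c where c: "y = (\<Sum>s\<in>S. c s *\<^sub>R s)" "\<forall>s\<in>S. 0 \<le> c s"
    unfolding convex_cone_hull_finite[OF assms(1)] by auto
  have "representation S y = (\<lambda>s. if s \<in> S then c s else 0)"
  proof (rule representation_eqI[OF assms(2,3)])
    have eq: "{b. (if b \<in> S then c b else 0) \<noteq> 0} = {b\<in>S. c b \<noteq> 0}" by auto
    show "finite {b. (if b \<in> S then c b else 0) \<noteq> 0}"
      unfolding eq using assms(1) by auto
    show "(\<Sum>b | (if b \<in> S then c b else 0) \<noteq> 0. (if b \<in> S then c b else 0) *\<^sub>R b) = y"
      unfolding eq c(1) by (rule sum.mono_neutral_cong_left) (use assms(1) in auto)
  qed (auto split: if_splits)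
  then show "\<forall>s\<in>S. 0 \<le> representation S y s" using c(2) by auto
next
  assume "\<forall>s\<in>S. 0 \<le> representation S y s"
  moreover have "y = (\<Sum>s\<in>S. representation S y s *\<^sub>R s)"
    using sum_representation_eq[OF assms(2,3,1) order_refl] by simp
  ultimately show "y \<in> convex_cone hull S"
    unfolding convex_cone_hull_finite[OF assms(1)] by blast
qed

lemma linear_eq_on_cone_hull:
  assumes "linear f" "linear g" "\<And>s. s \<in> S \<Longrightarrow> f s = g s" "y \<in> convex_cone hull S"
  shows "f y = g y"
  using linear_eq_on[OF assms(1,2)] assms(3,4) convex_cone_hull_subset_span by blast

text \<open>For cones the definition of a face amounts to: a sum lies in the face only if both of its
  terms do. The midpoint of \<open>2a\<close> and \<open>2b\<close> is \<open>a + b\<close>, which is how segments enter.\<close>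

lemma face_of_convex_cone_addD:
  fixes C T :: "'a::real_vector set"
  assumes "convex_cone C" "convex_cone T" "T face_of C"
    and "a \<in> C" "b \<in> C" "a + b \<in> T"
  shows "a \<in> T"
proof (cases "a = b")
  case True
  have "(1/2) *\<^sub>R (a + b) \<in> T"
    using assms(2,6) by (intro convex_cone_scaleR) auto
  moreover have "(1/2) *\<^sub>R (a + b) = a"
    using True by (metis scaleR_half_double)
  ultimately show ?thesis by simp
next
  case False
  have "2 *\<^sub>R a \<in> C" "2 *\<^sub>R b \<in> C"
    using assms(1,4,5) by (simp_all add: convex_cone_scaleR)
  moreover have "a + b \<in> open_segment (2 *\<^sub>R a) (2 *\<^sub>R b)"
    unfolding in_segment using False by (intro conjI exI[of _ "1/2"]) auto
  ultimately have "2 *\<^sub>R a \<in> T"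
    using assms(3,6) unfolding face_of_def by blast
  then show ?thesis
    using convex_cone_scaleR[OF assms(2), of "1/2" "2 *\<^sub>R a"] by simp
qed

lemma face_of_convex_cone_sumD:
  fixes C T :: "'a::real_vector set"
  assumes "convex_cone C" "convex_cone T" "T face_of C"
    and "finite A" "\<And>i. i \<in> A \<Longrightarrow> f i \<in> C" "sum f A \<in> T" "i \<in> A"
  shows "f i \<in> T"
proof (rule face_of_convex_cone_addD[OF assms(1-3)])
  have "sum f B \<in> C" if "B \<subseteq> A" for B
    using finite_subset[OF that \<open>finite A\<close>] that
    by (induction) (auto intro: convex_cone_add[OF assms(1)] assms(5)
        convex_cone_contains_0[OF assms(1)])
  then show "sum f (A - {i}) \<in> C" by blast
  show "f i + sum f (A - {i}) \<in> T"
    using assms(4,6,7) by (simp add: sum.remove)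
qed (use assms in auto)

text \<open>Order units take the place of interior points of the cone, so that arguments moving slightly
  away from such a point need no topology.\<close>

lemma basis_sum_order_unit:
  fixes S :: "'a::real_vector set"
  assumes "finite S" "independent S" "span S = UNIV"
  obtains M where "M > 0" "M *\<^sub>R (\<Sum>s\<in>S. s) + v \<in> convex_cone hull S"
proof
  let ?M = "1 + (\<Sum>s\<in>S. \<bar>representation S v s\<bar>)"
  show "?M > 0" by (simp add: add_pos_nonneg sum_nonneg)
  have "?M *\<^sub>R (\<Sum>s\<in>S. s) + v = (\<Sum>s\<in>S. (?M + representation S v s) *\<^sub>R s)"
    using sum_representation_eq[of S v S] assms
    by (simp add: scaleR_sum_right scaleR_add_left sum.distrib)
  moreover have "0 \<le> ?M + representation S v s" if "s \<in> S" for s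
    using member_le_sum[OF that, of "\<lambda>s. \<bar>representation S v s\<bar>"] assms(1) by fastforce
  ultimately show "?M *\<^sub>R (\<Sum>s\<in>S. s) + v \<in> convex_cone hull S"
    unfolding convex_cone_hull_finite[OF assms(1)]
    by (intro CollectI exI[of _ "\<lambda>s. ?M + representation S v s"]) blast
qed

text \<open>Writing a basis element as a nonnegative combination of cone elements leaves no room for other
  coordinates, so any generating set contains a positive multiple of each basis element.\<close>

lemma simplicial_cone_basis_in_generators:
  fixes S G :: "'a::real_vector set"
  assumes "independent S" "finite S" "finite G" "convex_cone hull G = convex_cone hull S"
  obtains B where "B \<subseteq> G" "independent B" "convex_cone hull B = convex_cone hull S"
proof -
  have "\<exists>g\<in>G. \<exists>k>0. g = k *\<^sub>R s" if s: "s \<in> S" for s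
  proof -
    have "s \<in> convex_cone hull G" using s assms(4) by (simp add: hull_inc)
    then obtain c where c: "s = (\<Sum>g\<in>G. c g *\<^sub>R g)" "\<forall>g\<in>G. 0 \<le> c g"
      unfolding convex_cone_hull_finite[OF assms(3)] by auto
    have GC: "g \<in> convex_cone hull S" if "g \<in> G" for g
      using that assms(4) hull_inc by metis
    then have Gs: "g \<in> span S" if "g \<in> G" for g
      using that convex_cone_hull_subset_span by blast
    let ?r = "representation S"
    have pos: "0 \<le> ?r g t" if "g \<in> G" "t \<in> S" for g t
      using GC[OF that(1)] Gs that mem_cone_hull_iff_representation[OF assms(2,1)] by auto
    have "?r s = (\<lambda>t. \<Sum>g\<in>G. ?r (c g *\<^sub>R g) t)"
      by (subst c(1)) (rule representation_sum[OF assms(1)], use Gs in \<open>auto intro: span_mul\<close>)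
    then have rs: "?r s t = (\<Sum>g\<in>G. c g * ?r g t)" for t
      using Gs by (simp add: representation_scale[OF assms(1)])
    have "\<exists>g\<in>G. c g * ?r g s \<noteq> 0"
    proof (rule ccontr)
      assume "\<not> ?thesis"
      then have "?r s s = 0" unfolding rs by (simp add: sum.neutral)
      then show False using s by (simp add: representation_basis[OF assms(1)])
    qed
    then obtain g where g: "g \<in> G" "c g * ?r g s \<noteq> 0" by auto
    then have cg: "c g > 0" "?r g s > 0" using c(2) pos[OF g(1) s] by (auto simp: less_le)
    have "?r g t = 0" if t: "t \<in> S" "t \<noteq> s" for t
    proof -
      have "(\<Sum>g\<in>G. c g * ?r g t) = 0"
        using rs[of t] s t by (simp add: representation_basis[OF assms(1)])
      then have "c g * ?r g t = 0"
        using assms(3) g(1) c(2) pos t by (subst (asm) sum_nonneg_eq_0_iff) auto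
      then show ?thesis using cg by simp
    qed
    then have "(\<Sum>t\<in>S. ?r g t *\<^sub>R t) = (\<Sum>t\<in>S. if t = s then ?r g s *\<^sub>R s else 0)"
      by (intro sum.cong) auto
    then have "g = ?r g s *\<^sub>R s"
      using sum_representation_eq[OF assms(1) Gs[OF g(1)] assms(2) order_refl] s assms(2) by simp
    then show ?thesis using g(1) cg by blast
  qed
  then obtain h k where hk: "\<And>s. s \<in> S \<Longrightarrow> h s \<in> G \<and> k s > 0 \<and> h s = k s *\<^sub>R s"
    by metis
  show thesis
  proof
    show "h ` S \<subseteq> G" by (rule image_subsetI) (use hk in metis)
    have hS: "h ` S = (\<lambda>s. k s *\<^sub>R s) ` S" using hk by (intro image_cong) auto
    \<comment> \<open>Rescaling the elements of a basis is a linear map, with the inverse rescaling as left inverse.\<close>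
    obtain g where g: "linear g" "\<forall>s\<in>S. g s = k s *\<^sub>R s"
      using linear_independent_extend[OF assms(1), of "\<lambda>s. k s *\<^sub>R s"] by metis
    obtain l where l: "linear l" "\<forall>s\<in>S. l s = inverse (k s) *\<^sub>R s"
      using linear_independent_extend[OF assms(1), of "\<lambda>s. inverse (k s) *\<^sub>R s"] by metis
    have "l (g y) = y" if "y \<in> span S" for y
    proof -
      have "(l \<circ> g) y = id y"
      proof (rule linear_eq_on[OF linear_compose[OF g(1) l(1)] linear_id that])
        fix s assume "s \<in> S"
        then show "(l \<circ> g) s = id s" using hk[of s] g l by (simp add: linear_scale)
      qed
      then show ?thesis by simp
    qed
    then have "independent (g ` S)"
      by (intro linear_independent_injective_image[OF g(1) assms(1)] inj_on_inverseI)
    moreover have "g ` S = h ` S" unfolding hS using g(2) by (intro image_cong) auto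
    ultimately show "independent (h ` S)" by simp
    show "convex_cone hull (h ` S) = convex_cone hull S"
    proof
      show "convex_cone hull (h ` S) \<subseteq> convex_cone hull S"
        unfolding hS
      proof (intro hull_minimal image_subsetI convex_cone_convex_cone_hull)
        fix s assume "s \<in> S"
        then show "k s *\<^sub>R s \<in> convex_cone hull S"
          using hk[of s] by (simp add: convex_cone_hull_mul hull_inc)
      qed
      have "s \<in> convex_cone hull (h ` S)" if s: "s \<in> S" for s
      proof -
        have "inverse (k s) *\<^sub>R h s \<in> convex_cone hull (h ` S)"
          by (rule convex_cone_hull_mul[OF hull_inc[OF imageI[OF s]]])
             (use hk[OF s] in \<open>simp add: less_imp_le\<close>)
        then show ?thesis using hk[OF s] by simp
      qed
      then show "convex_cone hull S \<subseteq> convex_cone hull (h ` S)"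
        by (intro hull_minimal) (auto simp: convex_cone_convex_cone_hull)
    qed
  qed
qed

section \<open>Subspaces\<close>

text \<open>In the inductive step a line
  through a vector avoiding the earlier subspaces, in a direction outside the new one, meets each
  earlier subspace at most once, and so has infinitely many points left.\<close>

lemma exists_avoiding_subspaces:
  fixes \<V> :: "'a::real_vector set set"
  assumes "finite \<V>" "\<And>V. V \<in> \<V> \<Longrightarrow> subspace V" "\<And>V. V \<in> \<V> \<Longrightarrow> V \<noteq> UNIV"
  obtains v where "\<And>V. V \<in> \<V> \<Longrightarrow> v \<notin> V"
proof -
  have "\<exists>v. \<forall>V\<in>\<V>. v \<notin> V"
    using assms
  proof induction
    case (insert V \<V>)
    then obtain v where v: "\<forall>W\<in>\<V>. v \<notin> W" by auto
    show ?case
    proof (cases "v \<in> V")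
      case True
      obtain w where w: "w \<notin> V" using insert.prems(2)[of V] by auto
      have sub: "subspace V" using insert.prems(1) by simp
      have unique: "a = b" if W: "W \<in> \<V>" "w + a *\<^sub>R v \<in> W" "w + b *\<^sub>R v \<in> W" for W a b
      proof (rule ccontr)
        assume "a \<noteq> b"
        have sW: "subspace W" using insert.prems(1) W(1) by simp
        have "(a - b) *\<^sub>R v \<in> W"
          using subspace_diff[OF sW W(2,3)] by (simp add: scaleR_diff_left)
        then have "inverse (a - b) *\<^sub>R ((a - b) *\<^sub>R v) \<in> W"
          using sW subspace_scale by blast
        then show False using v W(1) \<open>a \<noteq> b\<close> by simp
      qed
      have "finite {a. w + a *\<^sub>R v \<in> W}" if "W \<in> \<V>" for W
      proof (cases "\<exists>b. w + b *\<^sub>R v \<in> W")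
        case True
        then obtain b where "w + b *\<^sub>R v \<in> W" by blast
        then have "{a. w + a *\<^sub>R v \<in> W} \<subseteq> {b}" using unique[OF that] by blast
        then show ?thesis using finite_subset by blast
      qed auto
      then have "finite (\<Union>W\<in>\<V>. {a. w + a *\<^sub>R v \<in> W})" using insert.hyps by blast
      then obtain a :: real where "a \<notin> (\<Union>W\<in>\<V>. {a. w + a *\<^sub>R v \<in> W})"
        using ex_new_if_finite infinite_UNIV_char_0 by blast
      moreover have "w + a *\<^sub>R v \<notin> V"
        using subspace_diff[OF sub _ subspace_scale[OF sub True], of "w + a *\<^sub>R v" a] w by auto
      ultimately show ?thesis by blast
    qed (use v in auto)
  qed auto
  then show thesis using that by blast
qed

section \<open>The functional as a minimal cost\<close>

text \<open>Scaling a generator by the inverse of its weight and then asking for the smallest dilation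
  of the hull that contains a point amounts to pricing each unit of the generator at its weight.\<close>

definition combination :: "('n::finite \<Rightarrow> 'a::real_vector) \<Rightarrow> real ^ 'n \<Rightarrow> 'a" where
  "combination x c = (\<Sum>i\<in>UNIV. (c $ i) *\<^sub>R x i)"

definition cost :: "real ^ 'n \<Rightarrow> real ^ 'n \<Rightarrow> real" where
  "cost \<alpha> c = (\<Sum>i\<in>UNIV. \<bar>c $ i\<bar> * \<alpha> $ i)"

lemma combination_add: "combination x (b + c) = combination x b + combination x c"
  by (simp add: combination_def scaleR_add_left sum.distrib)

lemma combination_scaleR: "combination x (k *\<^sub>R c) = k *\<^sub>R combination x c"
  by (simp add: combination_def scaleR_sum_right)

lemma combination_axis: "combination x (axis i k) = k *\<^sub>R x i"
proof -
  have "combination x (axis i k) = (\<Sum>j\<in>UNIV. if j = i then k *\<^sub>R x i else 0)"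
    unfolding combination_def by (intro sum.cong) (auto simp: axis_def)
  then show ?thesis by simp
qed

lemma cost_axis: "cost \<alpha> (axis i k) = \<bar>k\<bar> * \<alpha> $ i"
proof -
  have "cost \<alpha> (axis i k) = (\<Sum>j\<in>UNIV. if j = i then \<bar>k\<bar> * \<alpha> $ i else 0)"
    unfolding cost_def by (intro sum.cong) (auto simp: axis_def)
  then show ?thesis by simp
qed

lemma cost_scaleR: "cost \<alpha> (k *\<^sub>R c) = \<bar>k\<bar> * cost \<alpha> c"
  by (simp add: cost_def sum_distrib_left abs_mult mult.assoc)

lemma cost_add_le:
  assumes "\<And>i. 0 \<le> \<alpha> $ i"
  shows "cost \<alpha> (b + c) \<le> cost \<alpha> b + cost \<alpha> c"
  unfolding cost_def sum.distrib[symmetric]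
  by (intro sum_mono) (simp flip: distrib_right add: mult_right_mono assms)

lemma cost_nonneg: "(\<And>i. 0 \<le> \<alpha> $ i) \<Longrightarrow> 0 \<le> cost \<alpha> c"
  unfolding cost_def by (intro sum_nonneg) auto

lemma cost_add_weights: "cost (\<alpha> + \<beta>) c = cost \<alpha> c + cost \<beta> c"
  by (simp add: cost_def distrib_left sum.distrib)

lemma cost_scaleR_weights: "cost (k *\<^sub>R \<alpha>) c = k * cost \<alpha> c"
  by (simp add: cost_def sum_distrib_left mult.left_commute)

lemma continuous_on_cost: "continuous_on A (cost \<alpha>)"
  unfolding cost_def by (intro continuous_intros)

lemma scaled_hull_eq_cost_le_1:
  fixes x :: "'n::finite \<Rightarrow> 'a::real_vector"
  assumes pos: "\<And>i. 0 < \<alpha> $ i"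
  shows "scaled_hull x \<alpha> = {combination x c | c. cost \<alpha> c \<le> 1}" (is "_ = ?R")
proof
  let ?P = "range (\<lambda>i. inverse (\<alpha> $ i) *\<^sub>R x i) \<union> range (\<lambda>i. - (inverse (\<alpha> $ i) *\<^sub>R x i))"
  have nn: "0 \<le> \<alpha> $ i" for i using pos[of i] by simp
  have "convex ?R"
  proof (rule convexI)
    fix y z and u v :: real assume uv: "0 \<le> u" "0 \<le> v" "u + v = 1" and "y \<in> ?R" "z \<in> ?R"
    then obtain b c where bc: "y = combination x b" "cost \<alpha> b \<le> 1"
      "z = combination x c" "cost \<alpha> c \<le> 1" by auto
    have "cost \<alpha> (u *\<^sub>R b + v *\<^sub>R c) \<le> u * cost \<alpha> b + v * cost \<alpha> c"
      using cost_add_le[OF nn, of "u *\<^sub>R b" "v *\<^sub>R c"] uv by (simp add: cost_scaleR)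
    also have "\<dots> \<le> 1" using uv bc by (metis convex_bound_le)
    finally show "u *\<^sub>R y + v *\<^sub>R z \<in> ?R"
      by (intro CollectI exI[of _ "u *\<^sub>R b + v *\<^sub>R c"])
         (simp add: bc combination_add combination_scaleR)
  qed
  moreover have "?P \<subseteq> ?R"
  proof
    fix y assume "y \<in> ?P"
    then obtain i k where "y = combination x (axis i k)" "\<bar>k\<bar> = inverse (\<alpha> $ i)"
      using nn by (auto simp: combination_axis) (metis abs_minus_cancel abs_of_nonneg
        inverse_nonnegative_iff_nonnegative scaleR_minus_left)+
    then show "y \<in> ?R" using pos[of i] by (auto simp: cost_axis intro!: exI[of _ "axis i k"])
  qed
  ultimately show "scaled_hull x \<alpha> \<subseteq> ?R"
    unfolding scaled_hull_def by (intro hull_minimal)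
next
  let ?K = "scaled_hull x \<alpha>"
  have nn: "0 \<le> \<alpha> $ i" for i using pos[of i] by simp
  have cK: "convex ?K" by (simp add: scaled_hull_def)
  have vK: "sgn k *\<^sub>R (inverse (\<alpha> $ i) *\<^sub>R x i) \<in> ?K" if "k \<noteq> 0" for i k
    using that unfolding scaled_hull_def by (cases "k > 0") (auto intro!: hull_inc)
  have zK: "0 \<in> ?K"
  proof -
    fix i
    let ?y = "inverse (\<alpha> $ i) *\<^sub>R x i"
    have "(1/2) *\<^sub>R ?y + (1/2) *\<^sub>R (- ?y) \<in> ?K"
      using vK[of 1 i] vK[of "-1" i] by (intro convexD[OF cK]) auto
    then show ?thesis by simp
  qed
  show "?R \<subseteq> ?K"
  proof clarify
    fix c assume c: "cost \<alpha> c \<le> 1"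
    show "combination x c \<in> ?K"
    proof (cases "cost \<alpha> c = 0")
      case True
      then have "c $ i = 0" for i
        unfolding cost_def using nn pos[of i] by (subst (asm) sum_nonneg_eq_0_iff) auto
      then show ?thesis using zK by (simp add: combination_def)
    next
      case False
      let ?s = "cost \<alpha> c" and ?I = "{i. c $ i \<noteq> 0}"
      let ?f = "\<lambda>i. sgn (c $ i) *\<^sub>R (inverse (\<alpha> $ i) *\<^sub>R x i)"
      have s: "?s > 0" using False cost_nonneg[OF nn, of c] by simp
      have "(\<Sum>i\<in>?I. \<bar>c $ i\<bar> * \<alpha> $ i / ?s) = (\<Sum>i\<in>UNIV. \<bar>c $ i\<bar> * \<alpha> $ i / ?s)"
        by (intro sum.mono_neutral_left) auto
      also have "\<dots> = 1" using False by (simp flip: sum_divide_distrib cost_def)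
      finally have "(\<Sum>i\<in>?I. (\<bar>c $ i\<bar> * \<alpha> $ i / ?s) *\<^sub>R ?f i) \<in> ?K"
        using s nn vK by (intro convex_sum[OF _ cK]) auto
      also have "(\<Sum>i\<in>?I. (\<bar>c $ i\<bar> * \<alpha> $ i / ?s) *\<^sub>R ?f i) = (\<Sum>i\<in>UNIV. (c $ i / ?s) *\<^sub>R x i)"
      proof (rule sum.mono_neutral_cong_left)
        fix i assume "i \<in> ?I"
        show "(\<bar>c $ i\<bar> * \<alpha> $ i / ?s) *\<^sub>R ?f i = (c $ i / ?s) *\<^sub>R x i"
          using pos[of i] s by (simp add: sgn_if field_simps)
      qed auto
      also have "\<dots> = inverse ?s *\<^sub>R combination x c"
        by (simp add: combination_def scaleR_sum_right divide_inverse mult.commute)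
      finally have "(1 - ?s) *\<^sub>R 0 + ?s *\<^sub>R (inverse ?s *\<^sub>R combination x c) \<in> ?K"
        using zK s c by (intro convexD[OF cK]) auto
      then show ?thesis using s by simp
    qed
  qed
qed

text \<open>Coefficients of bounded cost form a compact set, so the linear programme has a solution.\<close>

lemma rho_attained:
  fixes x :: "'n::finite \<Rightarrow> 'a::real_normed_vector"
  assumes pos: "\<And>i. 0 < \<alpha> $ i" and rep: "\<exists>c. y = combination x c"
  shows "\<exists>c. y = combination x c \<and> rho x \<alpha> y = cost \<alpha> c \<and>
           (\<forall>b. y = combination x b \<longrightarrow> cost \<alpha> c \<le> cost \<alpha> b)"
proof -
  have nn: "0 \<le> \<alpha> $ i" for i using pos[of i] by simp
  obtain c0 where c0: "y = combination x c0" using rep by blast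
  let ?A = "{c. cost \<alpha> c \<le> cost \<alpha> c0} \<inter> {c. combination x c = y}"
  have "norm c \<le> (\<Sum>i\<in>UNIV. cost \<alpha> c0 / \<alpha> $ i)" if "c \<in> ?A" for c
  proof -
    have "\<bar>c $ i\<bar> \<le> cost \<alpha> c0 / \<alpha> $ i" for i
    proof -
      have "\<bar>c $ i\<bar> * \<alpha> $ i \<le> cost \<alpha> c"
        unfolding cost_def by (rule member_le_sum) (use nn in auto)
      then show ?thesis using pos[of i] that by (simp add: field_simps)
    qed
    then show ?thesis
      by (intro order_trans[OF norm_le_l1_cart] sum_mono) auto
  qed
  then have "bounded ?A" unfolding bounded_iff by blast
  moreover have "closed ?A"
  proof (intro closed_Int)
    show "closed {c. cost \<alpha> c \<le> cost \<alpha> c0}"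
      by (intro closed_Collect_le continuous_on_cost continuous_intros)
    have "continuous_on UNIV (combination x)"
      unfolding combination_def by (intro continuous_intros)
    then show "closed {c. combination x c = y}"
      by (intro closed_Collect_eq continuous_intros)
  qed
  ultimately have "compact ?A" by (simp add: compact_eq_bounded_closed)
  moreover have "c0 \<in> ?A" using c0 by simp
  ultimately obtain c where c: "c \<in> ?A" "\<forall>b\<in>?A. cost \<alpha> c \<le> cost \<alpha> b"
    using continuous_attains_inf[OF _ _ continuous_on_cost, of ?A \<alpha>] by blast
  have min: "cost \<alpha> c \<le> cost \<alpha> b" if "y = combination x b" for b
    using that c by (cases "cost \<alpha> b \<le> cost \<alpha> c0") auto
  have "r > 0 \<and> y \<in> (\<lambda>z. r *\<^sub>R z) ` scaled_hull x \<alpha> \<longleftrightarrow> r > 0 \<and> cost \<alpha> c \<le> r" for r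
  proof (intro conj_cong refl iffI)
    assume r: "r > 0"
    {
      assume "y \<in> (\<lambda>z. r *\<^sub>R z) ` scaled_hull x \<alpha>"
      then obtain b where b: "y = combination x (r *\<^sub>R b)" "cost \<alpha> b \<le> 1"
        unfolding scaled_hull_eq_cost_le_1[OF pos] by (auto simp: combination_scaleR)
      have "cost \<alpha> c \<le> r * cost \<alpha> b" using min[OF b(1)] r by (simp add: cost_scaleR)
      also have "\<dots> \<le> r" using r b(2) by simp
      finally show "cost \<alpha> c \<le> r" .
    }
    {
      assume "cost \<alpha> c \<le> r"
      then have "cost \<alpha> (inverse r *\<^sub>R c) \<le> 1" using r by (simp add: cost_scaleR field_simps)
      moreover have "y = r *\<^sub>R combination x (inverse r *\<^sub>R c)"
        using r c(1) by (simp add: combination_scaleR)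
      ultimately show "y \<in> (\<lambda>z. r *\<^sub>R z) ` scaled_hull x \<alpha>"
        unfolding scaled_hull_eq_cost_le_1[OF pos] by blast
    }
  qed
  then have rho_eq: "rho x \<alpha> y = Inf {r. r > 0 \<and> cost \<alpha> c \<le> r}"
    unfolding rho_def by simp
  have "Inf {r. r > 0 \<and> cost \<alpha> c \<le> r} = cost \<alpha> c"
  proof (rule antisym)
    show "Inf {r. r > 0 \<and> cost \<alpha> c \<le> r} \<le> cost \<alpha> c"
    proof (rule field_le_epsilon)
      fix e :: real assume "e > 0"
      then show "Inf {r. r > 0 \<and> cost \<alpha> c \<le> r} \<le> cost \<alpha> c + e"
        using cost_nonneg[OF nn, of c] by (intro cInf_lower bdd_belowI[of _ 0]) auto
    qed
    show "cost \<alpha> c \<le> Inf {r. r > 0 \<and> cost \<alpha> c \<le> r}"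
      using cost_nonneg[OF nn, of c] by (intro cInf_greatest) (auto intro!: exI[of _ "cost \<alpha> c + 1"])
  qed
  then show ?thesis using rho_eq c min by auto
qed

section \<open>Norms\<close>

lemma is_normD:
  assumes "is_norm p"
  shows "0 \<le> p y" "p y = 0 \<longleftrightarrow> y = 0" "p (c *\<^sub>R y) = \<bar>c\<bar> * p y" "p (y + z) \<le> p y + p z"
  using assms unfolding is_norm_def by auto

lemma is_norm_minus:
  assumes "is_norm p"
  shows "p (- y) = p y"
  using is_normD(3)[OF assms, of "-1" y] by simp

lemma is_norm_pos: "is_norm p \<Longrightarrow> y \<noteq> 0 \<Longrightarrow> 0 < p y"
  using is_normD(1,2)[of p y] by (auto simp: less_le)

lemma equivalent_norms_imp_is_norm: "p \<in> equivalent_norms \<Longrightarrow> is_norm p"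
  by (simp add: equivalent_norms_def)

lemma equivalent_norms_scale:
  assumes "p \<in> equivalent_norms" "c > 0"
  shows "(\<lambda>y. c * p y) \<in> equivalent_norms"
proof -
  obtain m M where M: "m > 0" "M > 0" "\<And>x. m * norm x \<le> p x" "\<And>x. p x \<le> M * norm x"
    using assms unfolding equivalent_norms_def by blast
  have p: "is_norm p"
    using assms by (auto dest: equivalent_norms_imp_is_norm)
  have "is_norm (\<lambda>y. c * p y)"
    unfolding is_norm_def using is_normD[OF p] assms(2)
    by (simp add: mult.left_commute flip: distrib_left)
  moreover have "c * m * norm y \<le> c * p y" "c * p y \<le> c * M * norm y" for y
    using M(3,4)[of y] assms(2) by (auto simp: mult.assoc)
  ultimately show ?thesis
    unfolding equivalent_norms_def using M(1,2) assms(2)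
    by (intro CollectI conjI exI[of _ "c * m"] exI[of _ "c * M"]) auto
qed

lemma is_norm_le_linear_on_cone_hull:
  assumes "is_norm p" "linear l" "\<And>s. s \<in> S \<Longrightarrow> p s \<le> l s" "y \<in> convex_cone hull S"
  shows "p y \<le> l y"
proof -
  have "convex_cone hull S \<subseteq> {y. p y \<le> l y}"
  proof (rule hull_minimal)
    show "convex_cone {y. p y \<le> l y}"
      unfolding convex_cone_iff
    proof (intro conjI allI impI ballI; (unfold mem_Collect_eq)?)
      show "p 0 \<le> l 0" using is_normD(2)[OF assms(1), of 0] linear_0[OF assms(2)] by simp
    next
      fix y z assume "p y \<le> l y" "p z \<le> l z"
      then show "p (y + z) \<le> l (y + z)"
        using is_normD(4)[OF assms(1), of y z] linear_add[OF assms(2), of y z] by simp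
    next
      fix y and c :: real assume "p y \<le> l y" "0 \<le> c"
      then show "p (c *\<^sub>R y) \<le> l (c *\<^sub>R y)"
        by (simp add: is_normD(3)[OF assms(1)] linear_scale[OF assms(2)] mult_left_mono)
    qed
  qed (use assms(3) in auto)
  then show ?thesis using assms(4) by auto
qed

text \<open>A norm that agrees with a linear functional near one point dominates it everywhere, by
  convexity along the segment from that point.\<close>

lemma linear_on_full_cone_le_norm:
  fixes S :: "'a::real_vector set"
  assumes "is_norm p" "linear l" "finite S" "independent S" "span S = UNIV"
    and "\<And>y. y \<in> convex_cone hull S \<Longrightarrow> p y = l y"
  shows "l v \<le> p v"
proof -
  let ?u = "\<Sum>s\<in>S. s"
  obtain M where M: "M > 0" "M *\<^sub>R ?u + v \<in> convex_cone hull S"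
    using basis_sum_order_unit[OF assms(3-5)] by blast
  have u: "?u \<in> convex_cone hull S"
    unfolding convex_cone_hull_finite[OF assms(3)] by (intro CollectI exI[of _ "\<lambda>_. 1"]) auto
  have "M * l ?u + l v = l (M *\<^sub>R ?u + v)"
    by (simp add: linear_add[OF assms(2)] linear_scale[OF assms(2)])
  also have "\<dots> = p (M *\<^sub>R ?u + v)" using assms(6)[OF M(2)] by simp
  also have "\<dots> \<le> M * p ?u + p v"
    using is_normD(3,4)[OF assms(1)] M(1) by (metis abs_of_pos)
  finally show ?thesis using assms(6)[OF u] by simp
qed

lemma extreme_point_of_linear_image:
  assumes "linear f" "inj f"
  shows "f y extreme_point_of f ` S \<longleftrightarrow> y extreme_point_of S"
  by (simp add: extreme_point_of_def inj_image_mem_iff open_segment_linear_image assms)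

section \<open>Norms determined by a direction set\<close>

locale direction_frame =
  fixes E :: "'a::real_normed_vector set" and x :: "'n::finite \<Rightarrow> 'a"
  assumes direction_set: "direction_set E"
    and antipodal_representatives: "antipodal_representatives x E"
begin

lemma finite_E: "finite E"
  using direction_set by (simp add: direction_set_def)

lemma norm_E: "e \<in> E \<Longrightarrow> norm e = 1"
  using direction_set by (auto simp: direction_set_def)

lemma nonzero_E: "e \<in> E \<Longrightarrow> e \<noteq> 0"
  using norm_E by fastforce

lemma minus_E: "e \<in> E \<Longrightarrow> - e \<in> E"
  using direction_set by (auto simp: direction_set_def)

lemma x_in_E: "x i \<in> E"
  using antipodal_representatives by (auto simp: antipodal_representatives_def)

lemma E_cases:
  assumes "e \<in> E"
  obtains i where "e = x i" | i where "e = - x i"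
  using assms antipodal_representatives by (auto simp: antipodal_representatives_def)

text \<open>The hull of the directions is symmetric with nonempty interior, so averaging a ball inside it
  with the opposite of its centre yields a ball around the origin. Points of that ball are
  combinations of cost at most 1 for unit weights.\<close>

lemma bounded_representation:
  obtains K where "K > 0"
    "\<And>y. \<exists>c. y = combination x c \<and> (\<Sum>i\<in>UNIV. \<bar>c $ i\<bar>) \<le> K * norm y"
proof -
  let ?H = "convex hull E"
  have "?H = scaled_hull x (\<chi> i. 1)"
    using antipodal_representatives by (simp add: antipodal_representatives_def scaled_hull_def)
  then have H: "?H = {combination x c | c. (\<Sum>i\<in>UNIV. \<bar>c $ i\<bar>) \<le> 1}"
    by (simp add: scaled_hull_eq_cost_le_1 cost_def)
  obtain u where "u \<in> interior ?H" using direction_set by (auto simp: direction_set_def)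
  then obtain d where d: "d > 0" "ball u d \<subseteq> ?H" by (auto simp: mem_interior)
  have "uminus ` ?H = ?H"
    using direction_set by (simp add: direction_set_def convex_hull_linear_image linear_uminus)
  then have mu: "- u \<in> ?H" using d by (metis centre_in_ball image_eqI subsetD)
  have *: "\<exists>c. y = combination x c \<and> (\<Sum>i\<in>UNIV. \<bar>c $ i\<bar>) \<le> 4 / d * norm y" for y
  proof (cases "y = 0")
    case True
    then show ?thesis by (intro exI[of _ 0]) (simp add: combination_def)
  next
    case False
    define t where "t = d / (2 * norm y)"
    have t: "t > 0" using d False by (simp add: t_def)
    have "norm (t *\<^sub>R y) < d" using d(1) False by (simp add: t_def)
    then have "u + t *\<^sub>R y \<in> ?H" using d(2) by (auto simp: dist_norm)
    then have "(1/2) *\<^sub>R (- u) + (1/2) *\<^sub>R (u + t *\<^sub>R y) \<in> ?H"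
      using mu by (intro convexD[OF convex_convex_hull]) auto
    then have "(t / 2) *\<^sub>R y \<in> ?H" by (simp add: scaleR_add_right)
    then obtain c where c: "(t / 2) *\<^sub>R y = combination x c" "(\<Sum>i\<in>UNIV. \<bar>c $ i\<bar>) \<le> 1"
      unfolding H by auto
    have "y = (2 / t) *\<^sub>R ((t / 2) *\<^sub>R y)" using t by simp
    also have "\<dots> = combination x ((2 / t) *\<^sub>R c)" by (simp only: c(1) combination_scaleR)
    finally have "y = combination x ((2 / t) *\<^sub>R c)" .
    moreover have "(\<Sum>i\<in>UNIV. \<bar>((2 / t) *\<^sub>R c) $ i\<bar>) = 2 / t * (\<Sum>i\<in>UNIV. \<bar>c $ i\<bar>)"
      using t by (simp add: abs_mult sum_distrib_left)
    moreover have "2 / t * (\<Sum>i\<in>UNIV. \<bar>c $ i\<bar>) \<le> 2 / t"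
      using c(2) t by (intro mult_left_le) auto
    moreover have "2 / t = 4 / d * norm y" using d(1) False by (simp add: t_def field_simps)
    ultimately show ?thesis by (intro exI[of _ "(2 / t) *\<^sub>R c"]) simp
  qed
  show thesis by (rule that[OF _ *]) (use d in auto)
qed

lemma exists_combination: "\<exists>c. y = combination x c"
  using bounded_representation by metis

lemma span_E: "span E = UNIV"
proof -
  have "combination x c \<in> span E" for c
    unfolding combination_def by (intro span_sum span_mul span_base x_in_E)
  then show ?thesis using exists_combination by (metis UNIV_eq_I)
qed

lemma nontrivial: "\<exists>y::'a. y \<noteq> 0"
  using x_in_E nonzero_E by blast

lemma linear_imp_bounded_linear:
  fixes l :: "'a \<Rightarrow> 'b::real_normed_vector"
  assumes "linear l"
  shows "bounded_linear l"
proof -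
  obtain K where K: "K > 0"
    "\<And>y. \<exists>c. y = combination x c \<and> (\<Sum>i\<in>UNIV. \<bar>c $ i\<bar>) \<le> K * norm y"
    using bounded_representation by metis
  let ?B = "\<Sum>i\<in>UNIV. norm (l (x i))"
  have "norm (l y) \<le> norm y * (K * ?B)" for y
  proof -
    obtain c where c: "y = combination x c" "(\<Sum>i\<in>UNIV. \<bar>c $ i\<bar>) \<le> K * norm y"
      using K(2) by blast
    have "l y = (\<Sum>i\<in>UNIV. (c $ i) *\<^sub>R l (x i))"
      by (simp add: c(1) combination_def linear_sum[OF assms] linear_scale[OF assms])
    also have "norm \<dots> \<le> (\<Sum>i\<in>UNIV. \<bar>c $ i\<bar> * ?B)"
      by (intro order_trans[OF norm_sum] sum_mono) (auto intro!: mult_left_mono member_le_sum)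
    also have "\<dots> \<le> K * norm y * ?B"
      unfolding sum_distrib_right[symmetric]
      by (intro mult_right_mono c(2) sum_nonneg) auto
    finally show ?thesis by (simp add: mult_ac)
  qed
  then show ?thesis using assms by (auto intro!: bounded_linear_intro simp: linear_add linear_scale)
qed

lemma finite_independent:
  assumes "independent (S :: 'a set)"
  shows "finite S"
  using independent_span_bound[OF finite_E assms] span_E by simp

lemma card_eq_dim_iff_span:
  assumes "independent (S :: 'a set)"
  shows "card S = dim (UNIV :: 'a set) \<longleftrightarrow> span S = UNIV"
proof
  assume "span S = UNIV"
  then show "card S = dim (UNIV :: 'a set)"
    using dim_eq_card[of S UNIV] assms by simp
next
  assume card: "card S = dim (UNIV :: 'a set)"
  obtain B where B: "S \<subseteq> B" "independent B" "UNIV \<subseteq> span B"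
    using maximal_independent_subset_extend[OF subset_UNIV assms] by metis
  then have sB: "span B = UNIV" by blast
  then have "card B = dim (UNIV :: 'a set)" using dim_eq_card[of B UNIV] B(2) by simp
  then have "S = B"
    using card card_subset_eq[OF finite_independent[OF B(2)] B(1)] by simp
  then show "span S = UNIV" using sB by simp
qed

context
  fixes \<alpha> :: "real ^ 'n"
  assumes pos: "\<And>i. 0 < \<alpha> $ i"
begin

lemma rho_obtain:
  obtains c where "y = combination x c" "rho x \<alpha> y = cost \<alpha> c"
    "\<And>b. y = combination x b \<Longrightarrow> cost \<alpha> c \<le> cost \<alpha> b"
  using rho_attained[OF pos exists_combination] by metis

lemma rho_le_cost: "rho x \<alpha> (combination x c) \<le> cost \<alpha> c"
  using rho_obtain by metis

lemma rho_le_weight: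
  assumes "e = x i \<or> e = - x i"
  shows "rho x \<alpha> e \<le> \<alpha> $ i"
  using assms rho_le_cost[of "axis i 1"] rho_le_cost[of "axis i (-1)"]
  by (auto simp: combination_axis cost_axis)

text \<open>The functional is the largest sublinear one bounded by the weights on the directions.\<close>

lemma sublinear_le_rho:
  assumes add: "\<And>y z. f (y + z) \<le> f y + f z" and zero: "f 0 \<le> 0"
    and bound: "\<And>k i. f (k *\<^sub>R x i) \<le> \<bar>k\<bar> * \<alpha> $ i"
  shows "f y \<le> rho x \<alpha> y"
proof -
  obtain c where c: "y = combination x c" "rho x \<alpha> y = cost \<alpha> c"
    using rho_obtain by metis
  have "f (\<Sum>i\<in>A. (c $ i) *\<^sub>R x i) \<le> (\<Sum>i\<in>A. f ((c $ i) *\<^sub>R x i))" if "finite A" for A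
    using that by induction (auto intro: zero order_trans[OF add])
  then have "f y \<le> (\<Sum>i\<in>UNIV. f ((c $ i) *\<^sub>R x i))" by (simp add: c(1) combination_def)
  also have "\<dots> \<le> cost \<alpha> c" unfolding cost_def by (intro sum_mono bound)
  finally show ?thesis using c(2) by simp
qed

lemma is_norm_le_rho:
  assumes "is_norm p" "\<And>i. p (x i) \<le> \<alpha> $ i"
  shows "p y \<le> rho x \<alpha> y"
proof (rule sublinear_le_rho)
  show "p 0 \<le> 0" using is_normD(2)[OF assms(1), of 0] by simp
  show "p (k *\<^sub>R x i) \<le> \<bar>k\<bar> * \<alpha> $ i" for k i
    using assms(2)[of i] by (simp add: is_normD(3)[OF assms(1)] mult_left_mono)
qed (rule is_normD(4)[OF assms(1)])

lemma linear_le_rho: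
  assumes "linear l" "\<And>i. l (x i) \<le> \<alpha> $ i" "\<And>i. l (- x i) \<le> \<alpha> $ i"
  shows "l y \<le> rho x \<alpha> y"
proof (rule sublinear_le_rho)
  fix k :: real and i
  have "\<bar>l (x i)\<bar> \<le> \<alpha> $ i" using assms(2,3)[of i] by (simp add: linear_neg[OF assms(1)])
  then have "\<bar>k\<bar> * \<bar>l (x i)\<bar> \<le> \<bar>k\<bar> * \<alpha> $ i" by (intro mult_left_mono) auto
  moreover have "l (k *\<^sub>R x i) \<le> \<bar>k\<bar> * \<bar>l (x i)\<bar>"
    by (simp add: linear_scale[OF assms(1)] flip: abs_mult)
  ultimately show "l (k *\<^sub>R x i) \<le> \<bar>k\<bar> * \<alpha> $ i" by simp
qed (auto simp: linear_add[OF assms(1)] linear_0[OF assms(1)])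

lemma rho_equivalent_norm: "rho x \<alpha> \<in> equivalent_norms"
proof -
  have nn: "0 \<le> \<alpha> $ i" for i using pos[of i] by simp
  define m where "m = Min (range (\<lambda>i. \<alpha> $ i))"
  have m: "m > 0" "\<And>i. m \<le> \<alpha> $ i" using pos by (auto simp: m_def)
  have lower: "m * norm y \<le> rho x \<alpha> y" for y
  proof (rule sublinear_le_rho)
    fix y z :: 'a
    show "m * norm (y + z) \<le> m * norm y + m * norm z"
      using m(1) norm_triangle_ineq[of y z] by (simp flip: distrib_left)
  next
    fix k i show "m * norm (k *\<^sub>R x i) \<le> \<bar>k\<bar> * \<alpha> $ i"
      using mult_left_mono[OF m(2)[of i], of "\<bar>k\<bar>"] norm_E[OF x_in_E, of i]
      by (simp add: mult.commute)
  qed auto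
  obtain K where K: "K > 0"
    "\<And>y. \<exists>c. y = combination x c \<and> (\<Sum>i\<in>UNIV. \<bar>c $ i\<bar>) \<le> K * norm y"
    using bounded_representation by metis
  define A where "A = (\<Sum>i\<in>UNIV. \<alpha> $ i)"
  have A: "A > 0" "\<And>i. \<alpha> $ i \<le> A"
    unfolding A_def using pos nn by (auto intro!: sum_pos member_le_sum)
  have upper: "rho x \<alpha> y \<le> (A * K) * norm y" for y
  proof -
    obtain c where c: "y = combination x c" "(\<Sum>i\<in>UNIV. \<bar>c $ i\<bar>) \<le> K * norm y"
      using K(2) by blast
    have "rho x \<alpha> y \<le> cost \<alpha> c" using rho_le_cost c(1) by simp
    also have "\<dots> \<le> (\<Sum>i\<in>UNIV. \<bar>c $ i\<bar> * A)"
      unfolding cost_def by (intro sum_mono mult_left_mono A) auto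
    also have "\<dots> = A * (\<Sum>i\<in>UNIV. \<bar>c $ i\<bar>)" by (simp add: sum_distrib_left mult.commute)
    also have "\<dots> \<le> A * (K * norm y)" using c(2) A(1) by simp
    finally show ?thesis by (simp add: mult.assoc)
  qed
  have hom_le: "rho x \<alpha> (k *\<^sub>R y) \<le> \<bar>k\<bar> * rho x \<alpha> y" for k y
  proof -
    obtain c where c: "y = combination x c" "rho x \<alpha> y = cost \<alpha> c"
      using rho_obtain by metis
    then show ?thesis
      using rho_le_cost[of "k *\<^sub>R c"] by (simp add: combination_scaleR cost_scaleR)
  qed
  have "is_norm (rho x \<alpha>)"
    unfolding is_norm_def
  proof (intro conjI allI)
    fix y z :: 'a and k
    show nonneg: "0 \<le> rho x \<alpha> y" using order_trans[OF _ lower] m(1) by simp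
    show "rho x \<alpha> y = 0 \<longleftrightarrow> y = 0"
      using lower[of y] upper[of y] m(1) by (auto simp: mult_le_0_iff)
    show "rho x \<alpha> (y + z) \<le> rho x \<alpha> y + rho x \<alpha> z"
    proof -
      obtain b c where "y = combination x b" "rho x \<alpha> y = cost \<alpha> b"
        "z = combination x c" "rho x \<alpha> z = cost \<alpha> c"
        using rho_obtain by metis
      then show ?thesis
        using rho_le_cost[of "b + c"] cost_add_le[OF nn, of b c] by (simp add: combination_add)
    qed
    show "rho x \<alpha> (k *\<^sub>R y) = \<bar>k\<bar> * rho x \<alpha> y"
    proof (cases "k = 0")
      case True
      then show ?thesis using hom_le[of k y] lower[of 0] by auto
    next
      case False
      have "\<bar>k\<bar> * rho x \<alpha> y \<le> \<bar>k\<bar> * (\<bar>inverse k\<bar> * rho x \<alpha> (k *\<^sub>R y))"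
        using hom_le[of "inverse k" "k *\<^sub>R y"] False by (intro mult_left_mono) auto
      also have "\<dots> = rho x \<alpha> (k *\<^sub>R y)" using False by (simp add: field_simps)
      finally show ?thesis using hom_le[of k y] by simp
    qed
  qed
  then show ?thesis
    unfolding equivalent_norms_def using m(1) A(1) K(1) lower upper
    by (intro CollectI conjI exI[of _ m] exI[of _ "A * K"]) auto
qed

lemma is_norm_rho: "is_norm (rho x \<alpha>)"
  using rho_equivalent_norm by (rule equivalent_norms_imp_is_norm)

lemma rho_scale_weights:
  assumes "k > 0"
  shows "rho x (k *\<^sub>R \<alpha>) y = k * rho x \<alpha> y"
proof -
  have kpos: "0 < (k *\<^sub>R \<alpha>) $ i" for i using assms pos[of i] by simp
  obtain c where c: "y = combination x c" "rho x \<alpha> y = cost \<alpha> c"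
      "\<And>b. y = combination x b \<Longrightarrow> cost \<alpha> c \<le> cost \<alpha> b"
    using rho_obtain by metis
  obtain d where d: "y = combination x d" "rho x (k *\<^sub>R \<alpha>) y = cost (k *\<^sub>R \<alpha>) d"
      "\<And>b. y = combination x b \<Longrightarrow> cost (k *\<^sub>R \<alpha>) d \<le> cost (k *\<^sub>R \<alpha>) b"
    using rho_attained[OF kpos exists_combination] by metis
  show ?thesis
    using c(3)[OF d(1)] d(3)[OF c(1)] assms c(2) d(2) by (simp add: cost_scaleR_weights)
qed

lemma unit_ball_rho: "unit_ball_of (rho x \<alpha>) = scaled_hull x \<alpha>"
  unfolding scaled_hull_eq_cost_le_1[OF pos] unit_ball_of_def
proof (intro Collect_cong iffI)
  fix y assume "rho x \<alpha> y \<le> 1"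
  then show "\<exists>c. y = combination x c \<and> cost \<alpha> c \<le> 1" using rho_obtain by metis
next
  fix y assume "\<exists>c. y = combination x c \<and> cost \<alpha> c \<le> 1"
  then show "rho x \<alpha> y \<le> 1" using rho_le_cost order_trans by blast
qed

lemma rho_in_N_dir: "rho x \<alpha> \<in> N_dir E"
proof -
  have "y \<in> Dir E" if y: "y extreme_point_of unit_ball_of (rho x \<alpha>)" for y
  proof -
    have "y \<in> range (\<lambda>i. inverse (\<alpha> $ i) *\<^sub>R x i) \<union> range (\<lambda>i. - (inverse (\<alpha> $ i) *\<^sub>R x i))"
      using y unfolding unit_ball_rho scaled_hull_def by (rule extreme_point_of_convex_hull)
    then obtain i where "y = inverse (\<alpha> $ i) *\<^sub>R x i \<or> y = inverse (\<alpha> $ i) *\<^sub>R (- x i)"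
      by auto
    then obtain e where "e \<in> E" "y = inverse (\<alpha> $ i) *\<^sub>R e"
      using x_in_E[of i] minus_E[OF x_in_E, of i] by blast
    then show ?thesis
      unfolding Dir_def using pos[of i]
      by (intro CollectI exI[of _ "inverse (\<alpha> $ i)"] exI[of _ e]) simp
  qed
  then show ?thesis using rho_equivalent_norm by (auto simp: N_dir_def)
qed

end

text \<open>The combination that is optimal for \<open>\<alpha> + \<beta>\<close> competes in the minimisation for each of \<open>\<alpha>\<close> and
  \<open>\<beta>\<close>. The converse inequality needs a combination optimal for both at once; providing one is the
  purpose of the cones of a fan, and in the plane of the sectors between adjacent directions.\<close>

lemma rho_add_weights_ge:
  assumes pos: "\<And>i. 0 < \<alpha> $ i" "\<And>i. 0 < \<beta> $ i"
  shows "rho x \<alpha> y + rho x \<beta> y \<le> rho x (\<alpha> + \<beta>) y"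
proof -
  have "0 < (\<alpha> + \<beta>) $ i" for i using pos[of i] by simp
  then obtain c where "y = combination x c" "rho x (\<alpha> + \<beta>) y = cost (\<alpha> + \<beta>) c"
    using rho_obtain by metis
  then show ?thesis
    using rho_le_cost[of \<alpha> c] rho_le_cost[of \<beta> c] pos by (simp add: cost_add_weights)
qed

text \<open>If the value at a direction is smaller than its weight, the weight can be lowered to that value
  without changing the functional, because the hull already contains the direction scaled by the
  inverse of the value. If they are equal, lowering the weight lowers the value.\<close>

lemma R_dir_iff: "\<alpha> \<in> R_dir x \<longleftrightarrow> (\<forall>i. 0 < \<alpha> $ i \<and> rho x \<alpha> (x i) = \<alpha> $ i)"
proof (intro iffI allI conjI)
  fix i assume R: "\<alpha> \<in> R_dir x"
  then have pos: "0 < \<alpha> $ j" for j by (simp add: R_dir_def)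
  then show "0 < \<alpha> $ i" .
  let ?r = "rho x \<alpha> (x i)"
  have le: "?r \<le> \<alpha> $ i" using rho_le_weight[OF pos] by simp
  have r: "?r > 0" using is_norm_pos[OF is_norm_rho[OF pos] nonzero_E[OF x_in_E]] .
  show "?r = \<alpha> $ i"
  proof (rule ccontr)
    assume "?r \<noteq> \<alpha> $ i"
    let ?e = "\<alpha> $ i - ?r"
    let ?a = "\<chi> j. if j = i then \<alpha> $ i - ?e else \<alpha> $ j"
    have apos: "0 < ?a $ j" for j using r pos by simp
    have ne: "rho x ?a \<noteq> rho x \<alpha>"
      using R le r \<open>?r \<noteq> \<alpha> $ i\<close> unfolding R_dir_def admissible_def by auto
    have "rho x \<alpha> y \<le> rho x ?a y" for y
      by (rule is_norm_le_rho[OF apos is_norm_rho[OF pos]])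
         (use rho_le_weight[OF pos] in auto)
    moreover have "rho x ?a y \<le> rho x \<alpha> y" for y
    proof (rule is_norm_le_rho[OF pos is_norm_rho[OF apos]])
      fix j
      show "rho x ?a (x j) \<le> \<alpha> $ j"
        using rho_le_weight[OF apos, of "x j" j] le by (auto split: if_splits)
    qed
    ultimately have "rho x ?a = rho x \<alpha>" by (intro ext antisym)
    with ne show False ..
  qed
next
  assume *: "\<forall>i. 0 < \<alpha> $ i \<and> rho x \<alpha> (x i) = \<alpha> $ i"
  show "\<alpha> \<in> R_dir x"
    unfolding R_dir_def admissible_def
  proof (intro CollectI conjI allI impI)
    fix i and e :: real assume e: "0 < e \<and> e < \<alpha> $ i"
    let ?a = "\<chi> j. if j = i then \<alpha> $ i - e else \<alpha> $ j"
    have apos: "0 < ?a $ j" for j using * e by simp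
    have "rho x ?a (x i) \<le> \<alpha> $ i - e" using rho_le_weight[OF apos, of "x i" i] by simp
    then have "rho x ?a (x i) < rho x \<alpha> (x i)" using * e by simp
    then show "rho x ?a \<noteq> rho x \<alpha>" by auto
  qed (use * in auto)
qed

lemma R_dirD:
  assumes "\<alpha> \<in> R_dir x"
  shows "0 < \<alpha> $ i" "rho x \<alpha> (x i) = \<alpha> $ i"
  using assms R_dir_iff by auto

lemma inj_on_rho_R_dir: "inj_on (rho x) (R_dir x)"
  by (intro inj_onI) (metis R_dirD(2) vec_eq_iff)

lemma R_dir_scale:
  assumes "\<alpha> \<in> R_dir x" "k > 0"
  shows "k *\<^sub>R \<alpha> \<in> R_dir x"
  using R_dirD[OF assms(1)] rho_scale_weights[OF R_dirD(1)[OF assms(1)] assms(2)] assms(2)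
  unfolding R_dir_iff by simp

lemma R_dir_add:
  assumes "\<alpha> \<in> R_dir x" "\<beta> \<in> R_dir x" "rho x (\<alpha> + \<beta>) = (\<lambda>y. rho x \<alpha> y + rho x \<beta> y)"
  shows "\<alpha> + \<beta> \<in> R_dir x"
  using R_dirD[OF assms(1)] R_dirD[OF assms(2)] unfolding R_dir_iff assms(3)
  by (simp add: add_pos_pos)

lemma norm_weights_in_R_dir:
  assumes "is_norm p" "rho x (multiindex x p) = p"
  shows "multiindex x p \<in> R_dir x"
  unfolding R_dir_iff assms(2)
  using is_norm_pos[OF assms(1) nonzero_E[OF x_in_E]] by (simp add: multiindex_def)

lemma N_dir_scale:
  assumes "p \<in> N_dir E" "k > 0"
  shows "(\<lambda>y. k * p y) \<in> N_dir E"
proof -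
  have p: "p \<in> equivalent_norms" using assms(1) by (simp add: N_dir_def)
  note p' = is_normD(3)[OF equivalent_norms_imp_is_norm[OF p]]
  have "z \<in> Dir E" if z: "z extreme_point_of unit_ball_of (\<lambda>y. k * p y)" for z
  proof -
    have ball: "unit_ball_of p = (\<lambda>y. k *\<^sub>R y) ` unit_ball_of (\<lambda>y. k * p y)"
    proof (intro set_eqI iffI)
      fix y assume "y \<in> unit_ball_of p"
      then show "y \<in> (\<lambda>y. k *\<^sub>R y) ` unit_ball_of (\<lambda>y. k * p y)"
        using assms(2)
        by (intro image_eqI[of _ _ "inverse k *\<^sub>R y"]) (auto simp: unit_ball_of_def p' simp flip: mult.assoc)
    qed (use assms(2) in \<open>auto simp: unit_ball_of_def p'\<close>)
    have inj: "inj (\<lambda>y::'a. k *\<^sub>R y)" using assms(2) by (auto intro: injI)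
    have "k *\<^sub>R z extreme_point_of unit_ball_of p"
      unfolding ball using z inj by (simp add: extreme_point_of_linear_image)
    then have "k *\<^sub>R z \<in> Dir E" using assms(1) by (auto simp: N_dir_def)
    then obtain c e where ce: "c > 0" "e \<in> E" "k *\<^sub>R z = c *\<^sub>R e" by (auto simp: Dir_def)
    moreover have "z = (c / k) *\<^sub>R e"
      using arg_cong[of _ _ "\<lambda>v. inverse k *\<^sub>R v", OF ce(3)] assms(2)
      by (simp add: divide_inverse mult.commute)
    ultimately show ?thesis
      unfolding Dir_def using ce assms(2) by (intro CollectI exI[of _ "c / k"] exI[of _ e]) simp
  qed
  then show ?thesis using equivalent_norms_scale[OF p assms(2)] by (auto simp: N_dir_def)
qed

lemma cone_of_normsI:
  assumes "K \<subseteq> equivalent_norms"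
    and "\<And>p q. p \<in> K \<Longrightarrow> q \<in> K \<Longrightarrow> (\<lambda>y. p y + q y) \<in> K"
    and "\<And>p c. p \<in> K \<Longrightarrow> c > 0 \<Longrightarrow> (\<lambda>y. c * p y) \<in> K"
  shows "cone_of_norms (K :: ('a \<Rightarrow> real) set)"
  unfolding cone_of_norms_def
proof (intro conjI ballI allI impI assms)
  show "(\<lambda>y. 0) \<notin> K"
  proof
    assume "(\<lambda>y. 0) \<in> K"
    then have "is_norm (\<lambda>y::'a. 0)" using assms(1) equivalent_norms_imp_is_norm by blast
    then show False using nontrivial by (auto simp: is_norm_def)
  qed
qed

end

section \<open>Norms linear on the cones of a fan\<close>

locale direction_fan = direction_frame E x
  for E :: "'a::real_normed_vector set" and x :: "'n::finite \<Rightarrow> 'a" +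
  fixes \<F> :: "'a set set"
  assumes complete_fan: "complete_fan \<F>"
    and simplicial_fan: "simplicial_fan \<F>"
    and E_fan: "E_fan E \<F>"
begin

lemma fan: "finite \<F>" "C \<in> \<F> \<Longrightarrow> D \<in> \<F> \<Longrightarrow> (C \<inter> D) face_of C"
  "C \<in> \<F> \<Longrightarrow> D \<in> \<F> \<Longrightarrow> (C \<inter> D) face_of D"
  using complete_fan by (auto simp: complete_fan_def fan_def)

lemma cone_basis:
  assumes "C \<in> \<F>"
  obtains S where "S \<subseteq> E" "independent S" "C = convex_cone hull S"
proof -
  obtain T where T: "independent T" "C = convex_cone hull T"
    using simplicial_fan assms by (auto simp: simplicial_fan_def)
  obtain G where G: "G \<subseteq> E" "C = convex_cone hull G"
    using E_fan assms by (auto simp: E_fan_def)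
  obtain S where "S \<subseteq> G" "independent S" "convex_cone hull S = convex_cone hull T"
    using simplicial_cone_basis_in_generators[OF T(1) finite_independent[OF T(1)]
        finite_subset[OF G(1) finite_E]] G(2) T(2) by metis
  then show thesis using that G T by (metis order_trans)
qed

text \<open>The full-dimensional cones of the fan, called chambers, are represented by their generators, on
  which weights can be evaluated.\<close>

definition chamber_basis :: "'a set \<Rightarrow> bool" where
  "chamber_basis S \<longleftrightarrow>
     S \<subseteq> E \<and> independent S \<and> span S = UNIV \<and> convex_cone hull S \<in> \<F>"

lemma chamber_basisD:
  assumes "chamber_basis S"
  shows "S \<subseteq> E" "finite S" "independent S" "span S = UNIV" "convex_cone hull S \<in> \<F>"
  using assms finite_independent by (auto simp: chamber_basis_def)

text \<open>Approach a point along a direction that lies in no proper subspace spanned by a cone of the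
  fan. By the pigeonhole principle one cone contains infinitely many of the approximating points;
  it contains two points differing by a multiple of that direction, so it spans the space, and its
  defining coordinate inequalities pass to the limit.\<close>

lemma chambers_cover:
  obtains S where "chamber_basis S" "y \<in> convex_cone hull S"
proof -
  have "\<forall>C\<in>\<F>. \<exists>S. S \<subseteq> E \<and> independent S \<and> C = convex_cone hull S"
    using cone_basis by metis
  then obtain G where G: "\<And>C. C \<in> \<F> \<Longrightarrow> G C \<subseteq> E \<and> independent (G C) \<and> C = convex_cone hull (G C)"
    by metis
  obtain v where v: "\<And>C. C \<in> \<F> \<Longrightarrow> span (G C) \<noteq> UNIV \<Longrightarrow> v \<notin> span (G C)"
  proof (rule exists_avoiding_subspaces[of "{V \<in> (\<lambda>C. span (G C)) ` \<F>. V \<noteq> UNIV}"])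
    show "finite {V \<in> (\<lambda>C. span (G C)) ` \<F>. V \<noteq> UNIV}" using fan(1) by auto
  qed auto
  let ?z = "\<lambda>k::nat. y + inverse (real (Suc k)) *\<^sub>R v"
  let ?K = "\<lambda>C. {k. ?z k \<in> C}"
  have "(\<Union>C\<in>\<F>. ?K C) = UNIV" using complete_fan by (auto simp: complete_fan_def)
  then have "\<not> (\<forall>C\<in>\<F>. finite (?K C))" using fan(1) infinite_UNIV_nat by (metis finite_UN)
  then obtain C where C: "C \<in> \<F>" "infinite (?K C)" by blast
  let ?S = "G C"
  have S: "?S \<subseteq> E" "independent ?S" "C = convex_cone hull ?S" using G[OF C(1)] by auto
  have zS: "?z k \<in> span ?S" if "k \<in> ?K C" for k
    using that S(3) convex_cone_hull_subset_span[of ?S] by auto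
  have span: "span ?S = UNIV"
  proof (rule ccontr)
    assume ne: "span ?S \<noteq> UNIV"
    obtain k j where kj: "k \<in> ?K C" "j \<in> ?K C" "k < j"
      using C(2) unfolding infinite_nat_iff_unbounded by blast
    let ?d = "inverse (real (Suc k)) - inverse (real (Suc j))"
    have "?z k - ?z j \<in> span ?S" using kj zS by (intro span_diff) auto
    then have "?d *\<^sub>R v \<in> span ?S" by (simp add: scaleR_diff_left)
    then have "inverse ?d *\<^sub>R (?d *\<^sub>R v) \<in> span ?S" by (rule span_mul)
    moreover have "?d \<noteq> 0" using kj(3) by (simp add: inverse_eq_iff_eq)
    ultimately show False using v[OF C(1) ne] by simp
  qed
  let ?r = "representation ?S"
  have fS: "finite ?S" by (rule finite_independent[OF S(2)])
  have "0 \<le> ?r y s" if s: "s \<in> ?S" for s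
  proof (rule ccontr)
    assume neg: "\<not> 0 \<le> ?r y s"
    obtain N where N: "\<bar>?r v s\<bar> / (- ?r y s) < real N" using reals_Archimedean2 by blast
    obtain k where k: "k \<in> ?K C" "N \<le> k"
      using C(2) unfolding infinite_nat_iff_unbounded_le by blast
    have "0 \<le> ?r (?z k) s"
      using mem_cone_hull_iff_representation[OF fS S(2), of "?z k"] k(1) S(3) span s by auto
    also have "?r (?z k) s = ?r y s + inverse (real (Suc k)) * ?r v s"
      using span by (simp only: representation_add[OF S(2)] representation_scale[OF S(2)] UNIV_I)
    finally have "- ?r y s * real (Suc k) \<le> \<bar>?r v s\<bar>" by (simp add: field_simps)
    moreover have "\<bar>?r v s\<bar> < - ?r y s * real N" using N neg by (simp add: field_simps)
    moreover have "- ?r y s * real N \<le> - ?r y s * real (Suc k)"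
      using k(2) neg by (intro mult_left_mono) auto
    ultimately show False by simp
  qed
  then have "y \<in> convex_cone hull ?S"
    using mem_cone_hull_iff_representation[OF fS S(2), of y] span by auto
  then show thesis
    using that[of ?S] S C(1) span by (auto simp: chamber_basis_def)
qed

text \<open>The chamber found for the sum of the generators of a cone contains the whole cone, because it
  meets the cone in a face.\<close>

lemma cone_subset_chamber:
  assumes "C \<in> \<F>"
  obtains S where "chamber_basis S" "C \<subseteq> convex_cone hull S"
proof -
  obtain T where T: "T \<subseteq> E" "independent T" "C = convex_cone hull T"
    using cone_basis[OF assms] .
  obtain S where S: "chamber_basis S" "(\<Sum>t\<in>T. t) \<in> convex_cone hull S"
    using chambers_cover .
  let ?D = "convex_cone hull S"
  have "convex_cone (C \<inter> ?D)"
    using convex_cone_Inter[of "{C, ?D}"] T(3) convex_cone_convex_cone_hull by auto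
  moreover have "(\<Sum>t\<in>T. t) \<in> C"
    unfolding T(3) convex_cone_hull_finite[OF finite_independent[OF T(2)]]
    by (intro CollectI exI[of _ "\<lambda>_. 1"]) auto
  ultimately have "t \<in> C \<inter> ?D" if "t \<in> T" for t
    using face_of_convex_cone_sumD[of C "C \<inter> ?D" T "\<lambda>t. t" t] that S(2)
      fan(2)[OF assms chamber_basisD(5)[OF S(1)]] finite_independent[OF T(2)]
    unfolding T(3) by (auto simp: convex_cone_convex_cone_hull hull_inc)
  then have "C \<subseteq> ?D"
    unfolding T(3) by (intro hull_minimal) (auto simp: convex_cone_convex_cone_hull)
  then show thesis using that S(1) by blast
qed

text \<open>Admissibility refers to maximal cones. A chamber is one: it is a face of every cone of the fan
  above it, and the order unit dominates every point of such a cone, which the face property then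
  pulls into the chamber.\<close>

lemma chamber_maximal:
  assumes "chamber_basis S"
  shows "maximal_cone \<F> (convex_cone hull S)"
  unfolding maximal_cone_def
proof (intro conjI ballI impI)
  note S = chamber_basisD[OF assms]
  show "convex_cone hull S \<in> \<F>" by (rule S)
  fix D assume D: "D \<in> \<F>" "convex_cone hull S \<subseteq> D"
  have face: "convex_cone hull S face_of D"
    using fan(3)[OF S(5) D(1)] D(2) by (simp add: Int_absorb2)
  have cD: "convex_cone D"
    using cone_basis[OF D(1)] convex_cone_convex_cone_hull by metis
  have "v \<in> convex_cone hull S" if "v \<in> D" for v
  proof -
    obtain M where M: "M > 0" "M *\<^sub>R (\<Sum>s\<in>S. s) + (- v) \<in> convex_cone hull S"
      using basis_sum_order_unit[OF S(2-4)] .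
    have "M *\<^sub>R (\<Sum>s\<in>S. s) \<in> convex_cone hull S"
      unfolding convex_cone_hull_finite[OF S(2)] scaleR_sum_right
      using M(1) by (intro CollectI exI[of _ "\<lambda>_. M"]) auto
    then show ?thesis
      using face_of_convex_cone_addD[OF cD convex_cone_convex_cone_hull face that,
          of "M *\<^sub>R (\<Sum>s\<in>S. s) + (- v)"] M(2) D(2) by auto
  qed
  then show "D = convex_cone hull S" using D(2) by blast
qed

lemma R_fanE:
  assumes "\<alpha> \<in> R_fan E x \<F>"
  obtains w where "\<alpha> = multiindex x w" "symmetric_weight E w" "fan_admissible E \<F> w"
  using assms by (auto simp: R_fan_def)

lemma R_fan_pos: "\<alpha> \<in> R_fan E x \<F> \<Longrightarrow> 0 < \<alpha> $ i"
  using x_in_E by (auto simp: R_fan_def multiindex_def symmetric_weight_def)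

lemma rho_le_symmetric_weight:
  assumes "symmetric_weight E w" "e \<in> E"
  shows "rho x (multiindex x w) e \<le> w e"
proof -
  have pos: "0 < multiindex x w $ i" for i
    using assms(1) x_in_E by (simp add: multiindex_def symmetric_weight_def)
  have "w (- x i) = w (x i)" for i
    using assms(1) x_in_E by (simp add: symmetric_weight_def)
  then show ?thesis
    using rho_le_weight[OF pos, of e] assms(2) by (elim E_cases) (auto simp: multiindex_def)
qed

text \<open>On a chamber the functional is bounded above by the interpolating linear functional, by
  convexity. Admissibility makes the linear functional a competitor from below.\<close>

lemma rho_eq_on_chamber:
  assumes w: "symmetric_weight E w" "fan_admissible E \<F> w"
    and S: "chamber_basis S" and l: "linear l" "\<And>s. s \<in> S \<Longrightarrow> l s = w s"
  shows "\<And>y. y \<in> convex_cone hull S \<Longrightarrow> rho x (multiindex x w) y = l y"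
    and "\<And>e. e \<in> E \<Longrightarrow> l e \<le> w e"
proof -
  note S' = chamber_basisD[OF S]
  have pos: "0 < multiindex x w $ i" for i
    using w x_in_E by (simp add: multiindex_def symmetric_weight_def)
  have "card S = dim (UNIV :: 'a set)" using card_eq_dim_iff_span S' by blast
  then show le: "l e \<le> w e" if "e \<in> E" for e
    using w(2) chamber_maximal[OF S] S' l linear_imp_bounded_linear[OF l(1)] that
    unfolding fan_admissible_def by metis
  fix y assume y: "y \<in> convex_cone hull S"
  show "rho x (multiindex x w) y = l y"
  proof (rule antisym)
    show "rho x (multiindex x w) y \<le> l y"
      using is_norm_le_linear_on_cone_hull[OF is_norm_rho[OF pos] l(1) _ y]
        rho_le_symmetric_weight[OF w(1)] S'(1) l(2) by (metis subsetD)
    show "l y \<le> rho x (multiindex x w) y"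
    proof (rule linear_le_rho[OF pos l(1)])
      fix i
      show "l (x i) \<le> multiindex x w $ i" using le x_in_E by (simp add: multiindex_def)
      have "w (- x i) = w (x i)"
        using w(1) x_in_E[of i] by (auto simp: symmetric_weight_def)
      then show "l (- x i) \<le> multiindex x w $ i"
        using le[OF minus_E[OF x_in_E[of i]]] by (simp add: multiindex_def)
    qed
  qed
qed

lemma interpolating_functional:
  assumes "chamber_basis S"
  obtains l :: "'a \<Rightarrow> real" where "linear l" "\<And>s. s \<in> S \<Longrightarrow> l s = w s"
  using linear_independent_extend[OF chamber_basisD(3)[OF assms], of w] by metis

lemma rho_R_fan_in_N_fan:
  assumes "\<alpha> \<in> R_fan E x \<F>"
  shows "rho x \<alpha> \<in> N_fan \<F>"
proof -
  obtain w where w: "\<alpha> = multiindex x w" "symmetric_weight E w" "fan_admissible E \<F> w"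
    using R_fanE[OF assms] .
  have "\<exists>l. linear l \<and> (\<forall>y\<in>C. rho x \<alpha> y = l y)" if C: "C \<in> \<F>" for C
  proof -
    obtain S where S: "chamber_basis S" "C \<subseteq> convex_cone hull S"
      using cone_subset_chamber[OF C] .
    obtain l :: "'a \<Rightarrow> real" where l: "linear l" "\<And>s. s \<in> S \<Longrightarrow> l s = w s"
      using interpolating_functional[OF S(1)] by metis
    show ?thesis using rho_eq_on_chamber(1)[OF w(2,3) S(1) l] S(2) l(1) w(1) by blast
  qed
  then show ?thesis
    using rho_equivalent_norm[OF R_fan_pos[OF assms]] by (simp add: N_fan_def)
qed

text \<open>On a chamber the norm equals the functional interpolating its values, and it dominates that
  functional everywhere, which is admissibility. Both norms are then given on each chamber by the
  same functional.\<close>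

lemma N_fan_is_rho_of_values:
  assumes "p \<in> N_fan \<F>"
  shows "multiindex x p \<in> R_fan E x \<F>" "rho x (multiindex x p) = p"
proof -
  have p: "is_norm p" using assms by (auto simp: N_fan_def equivalent_norms_imp_is_norm)
  have sym: "symmetric_weight E p"
    using is_norm_pos[OF p nonzero_E] is_norm_minus[OF p] by (simp add: symmetric_weight_def)
  have adm: "fan_admissible E \<F> p"
    unfolding fan_admissible_def
  proof (intro allI impI ballI, elim conjE)
    fix C S l e
    assume CS: "maximal_cone \<F> C" "S \<subseteq> E" "independent S" "card S = dim (UNIV :: 'a set)"
      "C = convex_cone hull S" and l: "bounded_linear l" "\<forall>s\<in>S. l s = p s" and "e \<in> E"
    have C: "C \<in> \<F>" using CS(1) by (simp add: maximal_cone_def)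
    obtain m where m: "linear m" "\<forall>y\<in>C. p y = m y"
      using assms C by (auto simp: N_fan_def)
    have ll: "linear l" using l(1) by (rule bounded_linear.linear)
    have "p y = l y" if "y \<in> convex_cone hull S" for y
    proof -
      have "m y = l y"
        using m l(2) CS(5) by (intro linear_eq_on_cone_hull[OF m(1) ll _ that]) (simp add: hull_inc)
      then show ?thesis using m(2) that CS(5) by simp
    qed
    moreover have "span S = UNIV" using card_eq_dim_iff_span[OF CS(3)] CS(4) by simp
    ultimately show "l e \<le> p e"
      using linear_on_full_cone_le_norm[OF p ll finite_independent[OF CS(3)] CS(3)] by blast
  qed
  show "multiindex x p \<in> R_fan E x \<F>" using sym adm by (auto simp: R_fan_def)
  show "rho x (multiindex x p) = p"
  proof
    fix y
    obtain S where S: "chamber_basis S" "y \<in> convex_cone hull S" using chambers_cover .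
    obtain m where m: "linear m" "\<forall>y\<in>convex_cone hull S. p y = m y"
      using assms chamber_basisD(5)[OF S(1)] by (auto simp: N_fan_def)
    have "m s = p s" if "s \<in> S" for s using m(2) that by (simp add: hull_inc)
    then show "rho x (multiindex x p) y = p y"
      using rho_eq_on_chamber(1)[OF sym adm S(1) m(1) _ S(2)] m(2) S(2) by simp
  qed
qed

lemma rho_image_R_fan: "rho x ` R_fan E x \<F> = N_fan \<F>"
proof
  show "N_fan \<F> \<subseteq> rho x ` R_fan E x \<F>"
    using N_fan_is_rho_of_values by (metis image_eqI subsetI)
qed (use rho_R_fan_in_N_fan in blast)

lemma rho_add_R_fan:
  assumes "\<alpha> \<in> R_fan E x \<F>" "\<beta> \<in> R_fan E x \<F>"
  shows "\<alpha> + \<beta> \<in> R_fan E x \<F>" "rho x (\<alpha> + \<beta>) = (\<lambda>y. rho x \<alpha> y + rho x \<beta> y)"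
proof -
  obtain v where v: "\<alpha> = multiindex x v" "symmetric_weight E v" "fan_admissible E \<F> v"
    using R_fanE[OF assms(1)] .
  obtain w where w: "\<beta> = multiindex x w" "symmetric_weight E w" "fan_admissible E \<F> w"
    using R_fanE[OF assms(2)] .
  let ?u = "\<lambda>e. v e + w e"
  have sum: "\<alpha> + \<beta> = multiindex x ?u" by (simp add: v(1) w(1) multiindex_def vec_eq_iff)
  have sym: "symmetric_weight E ?u"
    using v(2) w(2) by (auto simp: symmetric_weight_def add_pos_pos)
  have "fan_admissible E \<F> ?u"
    unfolding fan_admissible_def
  proof (intro allI impI ballI, elim conjE)
    fix C S l e
    assume CS: "maximal_cone \<F> C" "S \<subseteq> E" "independent S" "card S = dim (UNIV :: 'a set)"
      "C = convex_cone hull S" and l: "bounded_linear l" "\<forall>s\<in>S. l s = ?u s" and e: "e \<in> E"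
    have S: "chamber_basis S"
      using CS card_eq_dim_iff_span[OF CS(3)] by (auto simp: chamber_basis_def maximal_cone_def)
    obtain a :: "'a \<Rightarrow> real" where a: "linear a" "\<And>s. s \<in> S \<Longrightarrow> a s = v s"
      using interpolating_functional[OF S] by metis
    obtain b :: "'a \<Rightarrow> real" where b: "linear b" "\<And>s. s \<in> S \<Longrightarrow> b s = w s"
      using interpolating_functional[OF S] by metis
    have "l e = a e + b e"
    proof (rule linear_eq_on[of l "\<lambda>y. a y + b y"])
      show "linear l" using l(1) by (rule bounded_linear.linear)
      show "linear (\<lambda>y. a y + b y)" using a(1) b(1) by (rule linear_compose_add)
      show "e \<in> span S" using chamber_basisD(4)[OF S] by simp
    qed (use a b l in simp)
    also have "\<dots> \<le> ?u e"
      using rho_eq_on_chamber(2)[OF v(2,3) S a e] rho_eq_on_chamber(2)[OF w(2,3) S b e] by simp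
    finally show "l e \<le> ?u e" .
  qed
  then show R: "\<alpha> + \<beta> \<in> R_fan E x \<F>" using sum sym by (auto simp: R_fan_def)
  show "rho x (\<alpha> + \<beta>) = (\<lambda>y. rho x \<alpha> y + rho x \<beta> y)"
  proof (intro ext antisym rho_add_weights_ge R_fan_pos assms)
    fix y
    obtain S where S: "chamber_basis S" "y \<in> convex_cone hull S" using chambers_cover .
    obtain a :: "'a \<Rightarrow> real" where a: "linear a" "\<And>s. s \<in> S \<Longrightarrow> a s = v s"
      using interpolating_functional[OF S(1)] by metis
    obtain b :: "'a \<Rightarrow> real" where b: "linear b" "\<And>s. s \<in> S \<Longrightarrow> b s = w s"
      using interpolating_functional[OF S(1)] by metis
    have "rho x (\<alpha> + \<beta>) s \<le> a s + b s" if "s \<in> S" for s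
      using rho_le_symmetric_weight[OF sym, of s] chamber_basisD(1)[OF S(1)] that a(2) b(2)
      by (auto simp: sum)
    then have "rho x (\<alpha> + \<beta>) y \<le> a y + b y"
      by (rule is_norm_le_linear_on_cone_hull[OF is_norm_rho[OF R_fan_pos[OF R]]
            linear_compose_add[OF a(1) b(1)] _ S(2)])
    then show "rho x (\<alpha> + \<beta>) y \<le> rho x \<alpha> y + rho x \<beta> y"
      using rho_eq_on_chamber(1)[OF v(2,3) S(1) a S(2)] rho_eq_on_chamber(1)[OF w(2,3) S(1) b S(2)]
      by (simp add: v(1) w(1))
  qed
qed

lemma R_fan_scale:
  assumes "\<alpha> \<in> R_fan E x \<F>" "k > 0"
  shows "k *\<^sub>R \<alpha> \<in> R_fan E x \<F>"
proof -
  obtain w where w: "\<alpha> = multiindex x w" "symmetric_weight E w" "fan_admissible E \<F> w"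
    using R_fanE[OF assms(1)] .
  have "fan_admissible E \<F> (\<lambda>e. k * w e)"
    unfolding fan_admissible_def
  proof (intro allI impI ballI, elim conjE)
    fix C S l e
    assume CS: "maximal_cone \<F> C" "S \<subseteq> E" "independent S" "card S = dim (UNIV :: 'a set)"
      "C = convex_cone hull S" and l: "bounded_linear l" "\<forall>s\<in>S. l s = k * w s" and e: "e \<in> E"
    have "chamber_basis S"
      using CS card_eq_dim_iff_span[OF CS(3)] by (auto simp: chamber_basis_def maximal_cone_def)
    moreover have "linear (\<lambda>y. inverse k * l y)"
      using bounded_linear.linear[OF l(1)] by (simp add: linear_iff distrib_left)
    ultimately have "inverse k * l e \<le> w e"
      using e assms(2) l(2) by (intro rho_eq_on_chamber(2)[OF w(2,3)]) auto
    then show "l e \<le> k * w e" using assms(2) by (simp add: field_simps)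
  qed
  moreover have "symmetric_weight E (\<lambda>e. k * w e)"
    using w(2) assms(2) by (auto simp: symmetric_weight_def)
  moreover have "k *\<^sub>R \<alpha> = multiindex x (\<lambda>e. k * w e)"
    by (simp add: w(1) multiindex_def vec_eq_iff)
  ultimately show ?thesis by (auto simp: R_fan_def)
qed

lemma rho_scale_R_fan:
  assumes "\<alpha> \<in> R_fan E x \<F>" "k > 0"
  shows "rho x (k *\<^sub>R \<alpha>) = (\<lambda>y. k * rho x \<alpha> y)"
  using rho_scale_weights[OF R_fan_pos[OF assms(1)] assms(2)] by blast

lemma blunt_cone_R_fan: "blunt_cone (R_fan E x \<F>)"
  unfolding blunt_cone_def
proof (intro conjI ballI allI impI)
  show "0 \<notin> R_fan E x \<F>" using R_fan_pos[of 0] by auto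
qed (auto intro: rho_add_R_fan(1) R_fan_scale)

lemma blunt_cone_R_fan_Int_R_dir: "blunt_cone (R_fan E x \<F> \<inter> R_dir x)"
  using blunt_cone_R_fan R_dir_scale R_dir_add[OF _ _ rho_add_R_fan(2)]
  unfolding blunt_cone_def by blast

lemma cone_of_norms_N_fan: "cone_of_norms (N_fan \<F>)"
proof (rule cone_of_normsI)
  show "N_fan \<F> \<subseteq> equivalent_norms" by (auto simp: N_fan_def)
next
  fix p q assume "p \<in> N_fan \<F>" "q \<in> N_fan \<F>"
  then obtain \<alpha> \<beta> where "\<alpha> \<in> R_fan E x \<F>" "p = rho x \<alpha>" "\<beta> \<in> R_fan E x \<F>" "q = rho x \<beta>"
    unfolding rho_image_R_fan[symmetric] by blast
  then show "(\<lambda>y. p y + q y) \<in> N_fan \<F>"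
    using rho_add_R_fan[of \<alpha> \<beta>] rho_R_fan_in_N_fan[of "\<alpha> + \<beta>"] by simp
next
  fix p and c :: real assume "p \<in> N_fan \<F>" "c > 0"
  then obtain \<alpha> where "\<alpha> \<in> R_fan E x \<F>" "p = rho x \<alpha>"
    unfolding rho_image_R_fan[symmetric] by blast
  then show "(\<lambda>y. c * p y) \<in> N_fan \<F>"
    using rho_scale_R_fan[of \<alpha> c] rho_R_fan_in_N_fan[OF R_fan_scale[of \<alpha> c]] \<open>c > 0\<close> by simp
qed

lemma bij_betw_rho_N_fan: "bij_betw (rho x) (R_fan E x \<F> \<inter> R_dir x) (N_fan \<F>)"
proof (rule bij_betw_imageI)
  show "inj_on (rho x) (R_fan E x \<F> \<inter> R_dir x)"
    using inj_on_rho_R_dir by (rule inj_on_subset) simp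
  have "p \<in> rho x ` (R_fan E x \<F> \<inter> R_dir x)" if "p \<in> N_fan \<F>" for p
  proof -
    have "is_norm p" using that by (auto simp: N_fan_def equivalent_norms_imp_is_norm)
    then show ?thesis
      using N_fan_is_rho_of_values[OF that] norm_weights_in_R_dir
      by (intro image_eqI[of _ _ "multiindex x p"]) auto
  qed
  then show "rho x ` (R_fan E x \<F> \<inter> R_dir x) = N_fan \<F>"
    using rho_R_fan_in_N_fan by blast
qed

text \<open>A direction spanning a ray of the fan is a generator of a chamber, and there the functional
  attains its weight.\<close>

lemma R_fan_subset_R_dir:
  assumes "uses_all_rays E \<F>"
  shows "R_fan E x \<F> \<subseteq> R_dir x"
proof
  fix \<alpha> assume \<alpha>: "\<alpha> \<in> R_fan E x \<F>"
  obtain w where w: "\<alpha> = multiindex x w" "symmetric_weight E w" "fan_admissible E \<F> w"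
    using R_fanE[OF \<alpha>] .
  have "rho x \<alpha> e = w e" if e: "e \<in> E" for e
  proof -
    let ?C = "convex_cone hull {e}"
    have C: "?C \<in> \<F>" using assms e by (simp add: uses_all_rays_def)
    obtain S where S: "chamber_basis S" "?C \<subseteq> convex_cone hull S"
      using cone_subset_chamber[OF C] .
    note S' = chamber_basisD[OF S(1)]
    have face: "?C face_of convex_cone hull S"
      using fan(3)[OF C S'(5)] S(2) by (simp add: Int_absorb2)
    have "e \<in> convex_cone hull S" using S(2) by (auto simp: hull_inc)
    then obtain c where c: "e = (\<Sum>s\<in>S. c s *\<^sub>R s)" "\<forall>s\<in>S. 0 \<le> c s"
      unfolding convex_cone_hull_finite[OF S'(2)] by auto
    obtain s where s: "s \<in> S" "c s \<noteq> 0"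
    proof (atomize_elim, rule ccontr)
      assume "\<not> (\<exists>s. s \<in> S \<and> c s \<noteq> 0)"
      then have "c s *\<^sub>R s = 0" if "s \<in> S" for s using that by force
      then show False using nonzero_E[OF e] c(1) by (simp add: sum.neutral)
    qed
    have "c s *\<^sub>R s \<in> ?C"
    proof (rule face_of_convex_cone_sumD[OF _ _ face S'(2), where f = "\<lambda>s. c s *\<^sub>R s"])
      show "c t *\<^sub>R t \<in> convex_cone hull S" if "t \<in> S" for t
        using that c(2) by (intro convex_cone_hull_mul hull_inc) auto
      show "(\<Sum>s\<in>S. c s *\<^sub>R s) \<in> ?C" using c(1) by (metis hull_inc singletonI)
    qed (use s in \<open>auto simp: convex_cone_convex_cone_hull\<close>)
    then obtain k where k: "c s *\<^sub>R s = k *\<^sub>R e" "k \<ge> 0"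
      using convex_cone_hull_finite[of "{e}"] by auto
    have "c s = norm (c s *\<^sub>R s)" using c(2) s(1) norm_E S'(1) by auto
    also have "\<dots> = k" using k norm_E[OF e] by simp
    finally have "s = e" using k(1) s(2) by simp
    then have "e \<in> S" using s(1) by simp
    then show ?thesis
      using interpolating_functional[OF S(1), of w] rho_eq_on_chamber(1)[OF w(2,3) S(1)]
      by (metis hull_inc w(1))
  qed
  then show "\<alpha> \<in> R_dir x"
    unfolding R_dir_iff using R_fan_pos[OF \<alpha>] x_in_E by (simp add: w(1) multiindex_def)
qed

end

section \<open>The planar case\<close>

text \<open>Equality in one triangle inequality propagates to the whole sector, since \<open>a u + b v\<close> and
  \<open>b u + a v\<close> sum to a multiple of \<open>u + v\<close>.\<close>

lemma additive_on_planar_cone: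
  fixes u v :: "'a::real_vector"
  assumes "is_norm p" "p (u + v) = p u + p v" "0 \<le> a" "0 \<le> b"
  shows "p (a *\<^sub>R u + b *\<^sub>R v) = a * p u + b * p v"
proof (rule antisym)
  have le: "p (r *\<^sub>R u + t *\<^sub>R v) \<le> r * p u + t * p v" if "0 \<le> r" "0 \<le> t" for r t
    using is_normD(4)[OF assms(1), of "r *\<^sub>R u" "t *\<^sub>R v"] that
    by (simp add: is_normD(3)[OF assms(1)])
  then show "p (a *\<^sub>R u + b *\<^sub>R v) \<le> a * p u + b * p v" using assms(3,4) by blast
  have "(a + b) * (p u + p v) = p ((a + b) *\<^sub>R (u + v))"
    using assms(2-4) by (simp add: is_normD(3)[OF assms(1)])
  also have "(a + b) *\<^sub>R (u + v) = (a *\<^sub>R u + b *\<^sub>R v) + (b *\<^sub>R u + a *\<^sub>R v)"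
    by (simp add: algebra_simps)
  also have "p \<dots> \<le> p (a *\<^sub>R u + b *\<^sub>R v) + (b * p u + a * p v)"
    using is_normD(4)[OF assms(1)] le[OF assms(4,3)] by (meson add_left_mono order_trans)
  finally show "a * p u + b * p v \<le> p (a *\<^sub>R u + b *\<^sub>R v)" by (simp add: algebra_simps)
qed

lemma independent_pair_unique:
  fixes e f :: "'a::real_vector"
  assumes "independent {e, f}" "e \<noteq> f" "a *\<^sub>R e + b *\<^sub>R f = a' *\<^sub>R e + b' *\<^sub>R f"
  shows "a = a'" "b = b'"
proof -
  have zero: "r = 0 \<and> t = 0" if "r *\<^sub>R e + t *\<^sub>R f = 0" for r t
  proof -
    have "(\<Sum>v\<in>{e, f}. (if v = e then r else t) *\<^sub>R v) = 0" using that assms(2) by simp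
    then have "(if v = e then r else t) = 0" if "v \<in> {e, f}" for v
      using that by (intro independentD[OF assms(1), of "{e, f}" "\<lambda>v. if v = e then r else t" v]) simp_all
    from this[of e] this[of f] show ?thesis using assms(2) by simp
  qed
  have "(a - a') *\<^sub>R e + (b - b') *\<^sub>R f = 0" using assms(3) by (simp add: algebra_simps)
  then show "a = a'" "b = b'" using zero[of "a - a'" "b - b'"] by auto
qed

lemma independent_pairI:
  fixes e f :: "'a::real_vector"
  assumes "independent {e, f}" "e \<noteq> f" "b \<noteq> 0"
  shows "independent {e, a *\<^sub>R e + b *\<^sub>R f}" "e \<noteq> a *\<^sub>R e + b *\<^sub>R f"
proof -
  show ne: "e \<noteq> a *\<^sub>R e + b *\<^sub>R f"
    using independent_pair_unique(2)[OF assms(1,2), of 1 0 a b] assms(3) by auto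
  have e: "e \<noteq> 0" using assms(1) dependent_zero[of "{e, f}"] by auto
  have "a *\<^sub>R e + b *\<^sub>R f \<notin> span {e}"
  proof
    assume "a *\<^sub>R e + b *\<^sub>R f \<in> span {e}"
    then obtain k where "a *\<^sub>R e + b *\<^sub>R f = k *\<^sub>R e + 0 *\<^sub>R f" by (auto simp: span_singleton)
    then show False using independent_pair_unique(2)[OF assms(1,2)] assms(3) by blast
  qed
  then have "independent (insert (a *\<^sub>R e + b *\<^sub>R f) {e})"
    using e by (simp add: independent_insert)
  then show "independent {e, a *\<^sub>R e + b *\<^sub>R f}" by (simp add: insert_commute)
qed

context direction_frame
begin

text \<open>By Minkowski's theorem the ball is the convex hull of its extreme points, which lie on the
  given directions. The theorem is applied in a Euclidean space isomorphic to the given one.\<close>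

lemma N_dir_is_rho_of_values:
  fixes T :: "'b::euclidean_space \<Rightarrow> 'a"
  assumes T: "linear T" "bij T" and p: "p \<in> N_dir E"
  shows "rho x (multiindex x p) = p"
proof -
  let ?\<alpha> = "multiindex x p"
  have eq: "p \<in> equivalent_norms" using p by (simp add: N_dir_def)
  then have n: "is_norm p" by (rule equivalent_norms_imp_is_norm)
  have pos: "0 < ?\<alpha> $ i" for i
    using is_norm_pos[OF n nonzero_E[OF x_in_E]] by (simp add: multiindex_def)
  note r = is_norm_rho[OF pos]
  have rho_E: "rho x ?\<alpha> e \<le> p e" if "e \<in> E" for e
    using that rho_le_weight[OF pos, of e] by (elim E_cases) (auto simp: multiindex_def is_norm_minus[OF n])
  let ?B = "{z. p (T z) \<le> 1}"
  have cvx: "convex_on UNIV (\<lambda>z. p (T z))"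
  proof (rule convex_onI)
    fix t :: real and y z assume t: "0 < t" "t < 1"
    show "p (T ((1 - t) *\<^sub>R y + t *\<^sub>R z)) \<le> (1 - t) * p (T y) + t * p (T z)"
      using is_normD(4)[OF n, of "(1 - t) *\<^sub>R T y" "t *\<^sub>R T z"] t
      by (simp add: linear_add[OF T(1)] linear_scale[OF T(1)] is_normD(3)[OF n])
  qed simp
  have "convex ?B"
    unfolding convex_alt
  proof (intro ballI allI impI CollectI)
    fix y z t assume yz: "y \<in> ?B" "z \<in> ?B" and t: "0 \<le> t \<and> t \<le> (1::real)"
    have "p (T ((1 - t) *\<^sub>R y + t *\<^sub>R z)) \<le> (1 - t) * p (T y) + t * p (T z)"
      using convex_onD[OF cvx, of t y z] t by simp
    also have "\<dots> \<le> 1" using yz t by (intro convex_bound_le) auto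
    finally show "p (T ((1 - t) *\<^sub>R y + t *\<^sub>R z)) \<le> 1" .
  qed
  moreover have "compact ?B"
  proof -
    have "continuous_on UNIV (\<lambda>z. p (T z))" using convex_on_continuous[OF open_UNIV cvx] .
    then have "closed ?B" by (intro closed_Collect_le continuous_on_const)
    moreover have "bounded ?B"
    proof -
      obtain g where g: "linear g" "g \<circ> T = id"
        using linear_injective_left_inverse[OF T(1) bij_is_inj[OF T(2)]] by blast
      obtain K where K: "K > 0" "\<And>y. norm (g y) \<le> norm y * K"
        using bounded_linear.pos_bounded[OF linear_imp_bounded_linear[OF g(1)]] by blast
      obtain m where m: "m > 0" "\<And>y. m * norm y \<le> p y"
        using eq by (auto simp: equivalent_norms_def)
      have "norm z \<le> K / m" if "z \<in> ?B" for z
      proof -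
        have "norm z = norm (g (T z))" using g(2) by (metis comp_apply id_apply)
        also have "\<dots> \<le> norm (T z) * K" by (rule K)
        also have "\<dots> \<le> (1 / m) * K"
          using m(1) m(2)[of "T z"] that K(1) by (intro mult_right_mono) (auto simp: field_simps)
        finally show ?thesis by simp
      qed
      then show ?thesis by (auto simp: bounded_iff)
    qed
    ultimately show ?thesis by (simp add: compact_eq_bounded_closed)
  qed
  ultimately have KM: "?B = convex hull {z. z extreme_point_of ?B}"
    using Krein_Milman_Minkowski by blast
  have ball: "unit_ball_of p = T ` ?B"
  proof
    show "unit_ball_of p \<subseteq> T ` ?B"
    proof
      fix y assume "y \<in> unit_ball_of p"
      moreover obtain z where "y = T z" using bij_is_surj[OF T(2)] by (rule surjE)
      ultimately show "y \<in> T ` ?B" by (simp add: unit_ball_of_def)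
    qed
  qed (auto simp: unit_ball_of_def)
  have "convex {y. rho x ?\<alpha> y \<le> 1}"
    using unit_ball_rho[OF pos] by (simp add: unit_ball_of_def scaled_hull_def)
  moreover have "T ` {z. z extreme_point_of ?B} \<subseteq> {y. rho x ?\<alpha> y \<le> 1}"
  proof clarify
    fix z assume z: "z extreme_point_of ?B"
    then have "T z extreme_point_of unit_ball_of p"
      unfolding ball using extreme_point_of_linear_image[OF T(1) bij_is_inj[OF T(2)]] by blast
    then have "T z \<in> Dir E" "p (T z) \<le> 1"
      using p by (auto simp: N_dir_def extreme_point_of_def unit_ball_of_def)
    then obtain c e where ce: "c > 0" "e \<in> E" "T z = c *\<^sub>R e" by (auto simp: Dir_def)
    have "rho x ?\<alpha> (T z) = c * rho x ?\<alpha> e" using ce by (simp add: is_normD(3)[OF r])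
    also have "\<dots> \<le> c * p e" using ce rho_E by simp
    also have "\<dots> = p (T z)" using ce by (simp add: is_normD(3)[OF n])
    finally show "rho x ?\<alpha> (T z) \<le> 1" using \<open>p (T z) \<le> 1\<close> by simp
  qed
  ultimately have "convex hull (T ` {z. z extreme_point_of ?B}) \<subseteq> {y. rho x ?\<alpha> y \<le> 1}"
    by (rule hull_minimal[rotated])
  then have sub: "T ` ?B \<subseteq> {y. rho x ?\<alpha> y \<le> 1}"
    using KM convex_hull_linear_image[OF T(1)] by metis
  have ball_le: "rho x ?\<alpha> y \<le> 1" if "p y \<le> 1" for y
  proof -
    have "y \<in> unit_ball_of p" using that by (simp add: unit_ball_of_def)
    then have "y \<in> T ` ?B" by (simp only: ball)
    then show ?thesis using sub by blast
  qed
  have "rho x ?\<alpha> y \<le> p y" for y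
  proof (cases "y = 0")
    case True
    then show ?thesis using is_normD(2)[OF r, of y] is_normD(1)[OF n, of y] by simp
  next
    case False
    then have "p y > 0" by (rule is_norm_pos[OF n])
    then have "rho x ?\<alpha> (inverse (p y) *\<^sub>R y) \<le> 1"
      by (intro ball_le) (simp add: is_normD(3)[OF n])
    then show ?thesis using \<open>p y > 0\<close> by (simp add: is_normD(3)[OF r] field_simps)
  qed
  moreover have "p y \<le> rho x ?\<alpha> y" for y
    by (rule is_norm_le_rho[OF pos n]) (simp add: multiindex_def)
  ultimately show ?thesis by (intro ext antisym)
qed

lemma planar_span:
  assumes "dim (UNIV :: 'a set) = 2" "independent {e, f :: 'a}" "e \<noteq> f"
  obtains a b where "y = a *\<^sub>R e + b *\<^sub>R f"
proof -
  have "span {e, f} = UNIV" using card_eq_dim_iff_span[OF assms(2)] assms(1,3) by simp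
  then have "y \<in> span {e, f}" by simp
  then obtain a where "y - a *\<^sub>R e \<in> span {f}" by (auto simp: span_breakdown_eq)
  then obtain b where "y - a *\<^sub>R e = b *\<^sub>R f" by (auto simp: span_singleton)
  then have "y = a *\<^sub>R e + b *\<^sub>R f" by (simp add: algebra_simps)
  then show thesis by (rule that)
qed

lemma planar_basis_in_E:
  assumes "dim (UNIV :: 'a set) = 2"
  obtains e f where "e \<in> E" "f \<in> E" "e \<noteq> f" "independent {e, f}"
proof -
  obtain B where B: "B \<subseteq> E" "independent B" "E \<subseteq> span B"
    using maximal_independent_subset[of E] by metis
  have "span E \<subseteq> span B" using B(3) subspace_span by (rule span_minimal)
  then have "span B = UNIV" using span_E by auto
  then have "card B = 2" using card_eq_dim_iff_span[OF B(2)] assms by simp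
  then show thesis using that B by (auto simp: card_2_iff)
qed

definition adjacent :: "'a \<Rightarrow> 'a \<Rightarrow> bool" where
  "adjacent e f \<longleftrightarrow> e \<in> E \<and> f \<in> E \<and> e \<noteq> f \<and> independent {e, f} \<and>
     (\<forall>g\<in>E. \<forall>a b. g = a *\<^sub>R e + b *\<^sub>R f \<longrightarrow> a \<le> 0 \<or> b \<le> 0)"

text \<open>Among the sectors containing a given point, one with the fewest directions has adjacent
  sides: a direction strictly inside would split it into two sectors, each losing a side.\<close>

lemma adjacent_sectors_cover:
  assumes d: "dim (UNIV :: 'a set) = 2"
  obtains e f a b where "adjacent e f" "0 \<le> a" "0 \<le> b" "y = a *\<^sub>R e + b *\<^sub>R f"
proof -
  define sector where "sector e f = {z. \<exists>a b. 0 \<le> a \<and> 0 \<le> b \<and> z = a *\<^sub>R e + b *\<^sub>R f}" for e f :: 'a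
  define P where "P q \<longleftrightarrow> (case q of (e, f) \<Rightarrow>
      e \<in> E \<and> f \<in> E \<and> e \<noteq> f \<and> independent {e, f} \<and> y \<in> sector e f)" for q
  define m where "m q = (case q of (e, f) \<Rightarrow> card (E \<inter> sector e f))" for q
  have comm: "sector e f = sector f e" for e f
    unfolding sector_def by (intro Collect_cong) (subst add.commute, blast)
  have "\<exists>q. P q"
  proof -
    obtain e f where ef: "e \<in> E" "f \<in> E" "e \<noteq> f" "independent {e, f}"
      using planar_basis_in_E[OF d] .
    have flip: "P (e, - f) \<or> P (e, f)" if ef: "e \<in> E" "f \<in> E" "e \<noteq> f" "independent {e, f}"
      and y: "y = a *\<^sub>R e + b *\<^sub>R f" "0 \<le> a" for e f a b
    proof (cases "0 \<le> b")
      case True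
      then show ?thesis using ef y by (auto simp: P_def sector_def)
    next
      case False
      have "independent {e, - f}" "e \<noteq> - f"
        using independent_pairI[OF ef(4,3), of "-1" 0] by auto
      moreover have "y \<in> sector e (- f)"
        using False y unfolding sector_def by (intro CollectI exI[of _ a] exI[of _ "- b"]) simp
      ultimately show ?thesis
        using ef(1) minus_E[OF ef(2)] by (simp add: P_def)
    qed
    obtain a b where ab: "y = a *\<^sub>R e + b *\<^sub>R f" using planar_span[OF d ef(4,3)] .
    show ?thesis
    proof (cases "0 \<le> a")
      case True
      then show ?thesis using flip[OF ef ab] by blast
    next
      case False
      have ind: "independent {- e, f}" "- e \<noteq> f"
        using independent_pairI[of f e "-1" 0] ef by (auto simp: insert_commute)
      have "y = (- a) *\<^sub>R (- e) + b *\<^sub>R f" using ab by simp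
      then show ?thesis
        using flip[OF minus_E[OF ef(1)] ef(2) ind(2,1), of "- a" b] False by auto
    qed
  qed
  then obtain q where q: "P q" "\<And>r. P r \<Longrightarrow> m q \<le> m r"
    using ex_has_least_nat[of P _ m] by blast
  obtain e f where qe: "q = (e, f)" by (cases q)
  have ef: "e \<in> E" "f \<in> E" "e \<noteq> f" "independent {e, f}" "y \<in> sector e f"
    using q(1) by (auto simp: P_def qe)
  have split: "\<exists>r. P r \<and> m r < m (e, f)"
    if ef: "e \<in> E" "f \<in> E" "e \<noteq> f" "independent {e, f}"
      and g: "g \<in> E" "g = a *\<^sub>R e + b *\<^sub>R f" "0 < a" "0 < b"
      and y: "y = s *\<^sub>R e + t *\<^sub>R f" "0 \<le> s" "0 \<le> t" "t * a \<le> s * b"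
    for e f g a b s t
  proof -
    have ind: "independent {e, g}" "e \<noteq> g"
      unfolding g(2) using independent_pairI[OF ef(4,3)] g(4) by auto
    have "y = (s - t * a / b) *\<^sub>R e + (t / b) *\<^sub>R g"
      using g(4) by (simp add: y(1) g(2) algebra_simps)
    moreover have "0 \<le> s - t * a / b" "0 \<le> t / b" using y g by (auto simp: field_simps)
    ultimately have "P (e, g)"
      unfolding P_def sector_def using ef g(1) ind by blast
    moreover have "E \<inter> sector e g \<subset> E \<inter> sector e f"
    proof
      have "sector e g \<subseteq> sector e f"
      proof
        fix z assume "z \<in> sector e g"
        then obtain u v where uv: "0 \<le> u" "0 \<le> v" "z = u *\<^sub>R e + v *\<^sub>R g" by (auto simp: sector_def)
        then have "z = (u + v * a) *\<^sub>R e + (v * b) *\<^sub>R f" by (simp add: g(2) algebra_simps)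
        moreover have "0 \<le> u + v * a" "0 \<le> v * b" using uv g by auto
        ultimately show "z \<in> sector e f" unfolding sector_def by blast
      qed
      then show "E \<inter> sector e g \<subseteq> E \<inter> sector e f" by blast
      have "f \<in> sector e f"
        unfolding sector_def by (intro CollectI exI[of _ 0] exI[of _ 1]) simp
      moreover have "f \<notin> sector e g"
      proof
        assume "f \<in> sector e g"
        then obtain u v where uv: "0 \<le> u" "0 \<le> v" "f = u *\<^sub>R e + v *\<^sub>R g" by (auto simp: sector_def)
        then have "0 *\<^sub>R e + 1 *\<^sub>R f = (u + v * a) *\<^sub>R e + (v * b) *\<^sub>R f"
          by (simp add: g(2) algebra_simps)
        note independent_pair_unique[OF ef(4,3) this]
        moreover have "u + v * a = 0 \<Longrightarrow> v * a = 0"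
          using uv g(3) add_nonneg_eq_0_iff[of u "v * a"] by simp
        ultimately show False using g(3) by simp
      qed
      ultimately show "E \<inter> sector e g \<noteq> E \<inter> sector e f" using ef(2) by blast
    qed
    then have "m (e, g) < m (e, f)" unfolding m_def using finite_E by (simp add: psubset_card_mono)
    ultimately show ?thesis by blast
  qed
  have "adjacent e f"
    unfolding adjacent_def
  proof (intro conjI ballI allI impI ef(1-4))
    fix g a b assume g: "g \<in> E" "g = a *\<^sub>R e + b *\<^sub>R f"
    show "a \<le> 0 \<or> b \<le> 0"
    proof (rule ccontr)
      assume "\<not> ?thesis"
      then have ab: "0 < a" "0 < b" by auto
      obtain s t where st: "0 \<le> s" "0 \<le> t" "y = s *\<^sub>R e + t *\<^sub>R f"
        using ef(5) by (auto simp: sector_def)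
      have "\<exists>r. P r \<and> m r < m (e, f)"
      proof (cases "t * a \<le> s * b")
        case True
        then show ?thesis using split[OF ef(1-4) g ab st(3,1,2)] by blast
      next
        case False
        have "\<exists>r. P r \<and> m r < m (f, e)"
        proof (rule split[OF ef(2,1) _ _ g(1) _ ab(2,1) _ st(2,1)])
          show "independent {f, e}" using ef(4) by (simp add: insert_commute)
        qed (use ef g st False in \<open>auto simp: add.commute\<close>)
        then show ?thesis by (simp add: m_def comm)
      qed
      then show False using q(2) qe by (meson not_less)
    qed
  qed
  moreover obtain s t where "0 \<le> s" "0 \<le> t" "y = s *\<^sub>R e + t *\<^sub>R f"
    using ef(5) by (auto simp: sector_def)
  ultimately show thesis by (rule that)
qed

text \<open>An optimal combination for \<open>e + f\<close> uses no direction strictly between \<open>e\<close> and \<open>f\<close>, so its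
  terms split into those on or beyond the line through \<open>e\<close>, with sum \<open>u\<close>, and those on or beyond
  the line through \<open>f\<close>, with sum \<open>v\<close>. Optimality makes the functional additive on the sector from
  \<open>u\<close> to \<open>v\<close>, and this sector contains \<open>e\<close> and \<open>f\<close>.\<close>

lemma rho_linear_on_adjacent_sector:
  assumes d: "dim (UNIV :: 'a set) = 2" and pos: "\<And>i. 0 < \<alpha> $ i"
    and adj: "adjacent e f" and ab: "0 \<le> a" "0 \<le> b"
  shows "rho x \<alpha> (a *\<^sub>R e + b *\<^sub>R f) = a * rho x \<alpha> e + b * rho x \<alpha> f"
proof -
  let ?p = "rho x \<alpha>"
  have n: "is_norm ?p" by (rule is_norm_rho[OF pos])
  have ef: "e \<noteq> f" "independent {e, f}" using adj by (auto simp: adjacent_def)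
  obtain c where c: "e + f = combination x c" "?p (e + f) = cost \<alpha> c"
    using rho_obtain[OF pos] by metis
  have "\<exists>A B. (c $ i) *\<^sub>R x i = A *\<^sub>R e + B *\<^sub>R f" for i
    using planar_span[OF d ef(2,1)] by metis
  then obtain A B where AB: "\<And>i. (c $ i) *\<^sub>R x i = A i *\<^sub>R e + B i *\<^sub>R f" by metis
  have outside: "A i \<le> 0 \<or> B i \<le> 0" for i
  proof (cases "c $ i = 0")
    case True
    then have "A i *\<^sub>R e + B i *\<^sub>R f = 0 *\<^sub>R e + 0 *\<^sub>R f" using AB[of i] by simp
    then show ?thesis using independent_pair_unique[OF ef(2,1)] by (metis order_refl)
  next
    case False
    let ?k = "inverse \<bar>c $ i\<bar>"
    have "?k *\<^sub>R ((c $ i) *\<^sub>R x i) \<in> E"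
      using False x_in_E minus_E[OF x_in_E] by (cases "c $ i > 0") auto
    moreover have "?k *\<^sub>R ((c $ i) *\<^sub>R x i) = (?k * A i) *\<^sub>R e + (?k * B i) *\<^sub>R f"
      by (simp only: AB scaleR_add_right scaleR_scaleR)
    ultimately have "?k * A i \<le> 0 \<or> ?k * B i \<le> 0" using adj unfolding adjacent_def by blast
    then show ?thesis using False by (simp add: mult_le_0_iff)
  qed
  define I where "I = {i. B i \<le> 0}"
  define Au Bu Av Bv where "Au = sum A I" "Bu = sum B I" "Av = sum A (- I)" "Bv = sum B (- I)"
  define u v where "u = (\<Sum>i\<in>I. (c $ i) *\<^sub>R x i)" "v = (\<Sum>i\<in>-I. (c $ i) *\<^sub>R x i)"
  have u: "u = Au *\<^sub>R e + Bu *\<^sub>R f" and v: "v = Av *\<^sub>R e + Bv *\<^sub>R f"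
    unfolding u_v_def AB Au_Bu_Av_Bv_def by (simp_all add: sum.distrib scaleR_sum_left)
  have split: "(\<Sum>i\<in>UNIV. g i) = sum g I + sum g (- I)" for g :: "'n \<Rightarrow> 'c::comm_monoid_add"
    by (subst sum.union_disjoint[symmetric]) auto
  have uv: "e + f = u + v" unfolding c(1) combination_def u_v_def by (rule split)
  have signs: "Bu \<le> 0" "Av \<le> 0"
    unfolding Au_Bu_Av_Bv_def using outside by (auto intro!: sum_nonpos simp: I_def)
  have "1 *\<^sub>R e + 1 *\<^sub>R f = (Au + Av) *\<^sub>R e + (Bu + Bv) *\<^sub>R f"
    using uv by (simp add: u v algebra_simps)
  note eqs = independent_pair_unique[OF ef(2,1) this]
  have term_le: "?p (\<Sum>i\<in>J. (c $ i) *\<^sub>R x i) \<le> (\<Sum>i\<in>J. \<bar>c $ i\<bar> * \<alpha> $ i)" for J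
  proof -
    have "finite J" by simp
    then show ?thesis
    proof induction
      case (insert i J)
      have "?p ((c $ i) *\<^sub>R x i) \<le> \<bar>c $ i\<bar> * \<alpha> $ i"
        using rho_le_weight[OF pos, of "x i" i] by (simp add: is_normD(3)[OF n] mult_left_mono)
      then show ?case
        using insert is_normD(4)[OF n, of "(c $ i) *\<^sub>R x i" "\<Sum>i\<in>J. (c $ i) *\<^sub>R x i"] by simp
    qed (use is_normD(2)[OF n, of 0] in simp)
  qed
  have "?p u + ?p v \<le> ?p (u + v)"
    using term_le[of I] term_le[of "- I"] c(2) unfolding uv cost_def split u_v_def by simp
  then have add: "?p (u + v) = ?p u + ?p v" using is_normD(4)[OF n, of u v] by simp
  \<comment> \<open>Cramer's rule for \<open>e\<close> and \<open>f\<close> in terms of \<open>u\<close> and \<open>v\<close>; the determinant is \<open>D\<close>.\<close>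
  define D where "D = 1 - Av - Bu"
  have D: "D > 0" using signs by (simp add: D_def)
  have comb: "D *\<^sub>R e = Bv *\<^sub>R u + (- Bu) *\<^sub>R v" "D *\<^sub>R f = (- Av) *\<^sub>R u + Au *\<^sub>R v"
  proof -
    have det: "Au = 1 - Av" "Bv = 1 - Bu" using eqs by auto
    show "D *\<^sub>R e = Bv *\<^sub>R u + (- Bu) *\<^sub>R v" "D *\<^sub>R f = (- Av) *\<^sub>R u + Au *\<^sub>R v"
      unfolding u v D_def det by (simp_all add: algebra_simps)
  qed
  have nn: "0 \<le> Au" "0 \<le> Bv" using eqs signs by auto
  have "D * ?p e = ?p (D *\<^sub>R e)" "D * ?p f = ?p (D *\<^sub>R f)"
    using D by (simp_all add: is_normD(3)[OF n])
  then have pe: "D * ?p e = Bv * ?p u + (- Bu) * ?p v"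
    and pf: "D * ?p f = (- Av) * ?p u + Au * ?p v"
    unfolding comb using signs nn by (simp_all only: additive_on_planar_cone[OF n add] neg_0_le_iff_le)
  have "D *\<^sub>R (a *\<^sub>R e + b *\<^sub>R f) = a *\<^sub>R (D *\<^sub>R e) + b *\<^sub>R (D *\<^sub>R f)"
    by (simp add: algebra_simps)
  also have "\<dots> = (a * Bv + b * (- Av)) *\<^sub>R u + (a * (- Bu) + b * Au) *\<^sub>R v"
    unfolding comb by (simp add: algebra_simps)
  finally have "D * ?p (a *\<^sub>R e + b *\<^sub>R f)
      = ?p ((a * Bv + b * (- Av)) *\<^sub>R u + (a * (- Bu) + b * Au) *\<^sub>R v)"
    using D is_normD(3)[OF n, of D "a *\<^sub>R e + b *\<^sub>R f"] by simp
  also have "\<dots> = (a * Bv + b * (- Av)) * ?p u + (a * (- Bu) + b * Au) * ?p v"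
    using ab nn signs
    by (intro additive_on_planar_cone[OF n add] add_nonneg_nonneg mult_nonneg_nonneg) auto
  also have "\<dots> = a * (D * ?p e) + b * (D * ?p f)" unfolding pe pf by (simp add: algebra_simps)
  also have "\<dots> = D * (a * ?p e + b * ?p f)" by (simp add: algebra_simps)
  finally show ?thesis using D by simp
qed

lemma rho_add_R_dir_planar:
  assumes d: "dim (UNIV :: 'a set) = 2" and R: "\<alpha> \<in> R_dir x" "\<beta> \<in> R_dir x"
  shows "rho x (\<alpha> + \<beta>) = (\<lambda>y. rho x \<alpha> y + rho x \<beta> y)"
proof (intro ext antisym rho_add_weights_ge R_dirD(1)[OF R(1)] R_dirD(1)[OF R(2)])
  fix y
  note pos = R_dirD(1)[OF R(1)] R_dirD(1)[OF R(2)]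
  have spos: "0 < (\<alpha> + \<beta>) $ i" for i using pos[of i] by simp
  note n = is_norm_rho[OF spos]
  have E_le: "rho x (\<alpha> + \<beta>) g \<le> rho x \<alpha> g + rho x \<beta> g" if "g \<in> E" for g
    using that rho_le_weight[OF spos, of g] R_dirD(2)[OF R(1)] R_dirD(2)[OF R(2)]
    by (elim E_cases) (auto simp: is_norm_minus[OF is_norm_rho[OF pos(1)]]
        is_norm_minus[OF is_norm_rho[OF pos(2)]])
  obtain e f a b where adj: "adjacent e f" and ab: "0 \<le> a" "0 \<le> b" and y: "y = a *\<^sub>R e + b *\<^sub>R f"
    using adjacent_sectors_cover[OF d] by metis
  have "rho x (\<alpha> + \<beta>) y = a * rho x (\<alpha> + \<beta>) e + b * rho x (\<alpha> + \<beta>) f"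
    unfolding y by (rule rho_linear_on_adjacent_sector[OF d spos adj ab])
  also have "\<dots> \<le> a * (rho x \<alpha> e + rho x \<beta> e) + b * (rho x \<alpha> f + rho x \<beta> f)"
    using adj ab by (intro add_mono mult_left_mono E_le) (auto simp: adjacent_def)
  also have "\<dots> = rho x \<alpha> y + rho x \<beta> y"
    unfolding y rho_linear_on_adjacent_sector[OF d pos(1) adj ab]
      rho_linear_on_adjacent_sector[OF d pos(2) adj ab] by (simp add: algebra_simps)
  finally show "rho x (\<alpha> + \<beta>) y \<le> rho x \<alpha> y + rho x \<beta> y" .
qed

lemma bij_betw_rho_N_dir_planar:
  assumes d: "dim (UNIV :: 'a set) = 2"
  shows "bij_betw (rho x) (R_dir x) (N_dir E)"
proof (rule bij_betw_imageI[OF inj_on_rho_R_dir])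
  obtain e f where ef: "e \<in> E" "f \<in> E" "e \<noteq> f" "independent {e, f}"
    using planar_basis_in_E[OF d] .
  let ?T = "\<lambda>z::real \<times> real. fst z *\<^sub>R e + snd z *\<^sub>R f"
  have lin: "linear ?T" by (simp add: linear_iff algebra_simps)
  have bij: "bij ?T"
  proof (rule bijI)
    show "inj ?T"
    proof (rule injI)
      fix z z' assume "?T z = ?T z'"
      from independent_pair_unique[OF ef(4,3) this] show "z = z'" by (rule prod_eqI)
    qed
    show "surj ?T"
    proof (rule surjI)
      fix y
      let ?c = "\<lambda>y. SOME z. y = ?T z"
      obtain a b where "y = a *\<^sub>R e + b *\<^sub>R f" using planar_span[OF d ef(4,3)] .
      then have "\<exists>z. y = ?T z" by (intro exI[of _ "(a, b)"]) simp
      then show "?T (?c y) = y" by (rule someI_ex[THEN sym])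
    qed
  qed
  have "p \<in> rho x ` R_dir x" if "p \<in> N_dir E" for p
  proof -
    have eq: "rho x (multiindex x p) = p" by (rule N_dir_is_rho_of_values[OF lin bij that])
    have "is_norm p" using that by (auto simp: N_dir_def equivalent_norms_imp_is_norm)
    then show ?thesis using norm_weights_in_R_dir eq by (metis imageI)
  qed
  then show "rho x ` R_dir x = N_dir E"
    using rho_in_N_dir R_dirD(1) by blast
qed

lemma blunt_cone_R_dir_planar:
  assumes d: "dim (UNIV :: 'a set) = 2"
  shows "blunt_cone (R_dir x)"
  unfolding blunt_cone_def
proof (intro conjI ballI allI impI)
  show "0 \<notin> R_dir x" using R_dirD(1)[of 0] by auto
qed (blast intro: R_dir_add rho_add_R_dir_planar[OF d], rule R_dir_scale)

lemma cone_of_norms_N_dir_planar: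
  assumes d: "dim (UNIV :: 'a set) = 2"
  shows "cone_of_norms (N_dir E)"
proof (rule cone_of_normsI)
  fix p q assume "p \<in> N_dir E" "q \<in> N_dir E"
  then obtain \<alpha> \<beta> where R: "\<alpha> \<in> R_dir x" "\<beta> \<in> R_dir x" "p = rho x \<alpha>" "q = rho x \<beta>"
    using bij_betw_imp_surj_on[OF bij_betw_rho_N_dir_planar[OF d]] by blast
  have "rho x (\<alpha> + \<beta>) \<in> N_dir E"
    using R_dir_add[OF R(1,2) rho_add_R_dir_planar[OF d R(1,2)]] R_dirD(1) rho_in_N_dir by blast
  then show "(\<lambda>y. p y + q y) \<in> N_dir E"
    using rho_add_R_dir_planar[OF d R(1,2)] R(3,4) by simp
next
  show "N_dir E \<subseteq> equivalent_norms" by (auto simp: N_dir_def)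
qed (rule N_dir_scale)

end

section \<open>The cones of norms and of weights\<close>

theorem theorem5p4:
  fixes E :: "'a::banach set"
    and x :: "'n::finite \<Rightarrow> 'a"
    and \<F> :: "'a set set"
  assumes finite_dim: "\<exists>B :: 'a set. finite B \<and> span B = UNIV"
    and E: "direction_set E"
    and x: "antipodal_representatives x E"
    and F: "complete_fan \<F>" "symmetric_fan \<F>" "simplicial_fan \<F>" "E_fan E \<F>"
  shows
    "((\<forall>\<alpha>\<in>R_dir x. \<forall>c>0. (\<lambda>y. c * rho x \<alpha> y) = rho x (c *\<^sub>R \<alpha>)) \<and>
      (\<forall>p\<in>N_dir E. \<forall>c>0. (\<lambda>y. c * p y) \<in> N_dir E))
     \<and>
     (cone_of_norms (N_fan \<F>) \<and>
      blunt_cone (R_fan E x \<F>) \<and>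
      (\<forall>\<alpha>\<in>R_fan E x \<F>. \<forall>\<beta>\<in>R_fan E x \<F>. rho x (\<alpha> + \<beta>) = (\<lambda>y. rho x \<alpha> y + rho x \<beta> y)) \<and>
      (\<forall>\<alpha>\<in>R_fan E x \<F>. \<forall>c>0. rho x (c *\<^sub>R \<alpha>) = (\<lambda>y. c * rho x \<alpha> y)) \<and>
      rho x ` R_fan E x \<F> = N_fan \<F> \<and>
      (uses_all_rays E \<F> \<longrightarrow> bij_betw (rho x) (R_fan E x \<F>) (N_fan \<F>)) \<and>
      blunt_cone (R_fan E x \<F> \<inter> R_dir x) \<and>
      bij_betw (rho x) (R_fan E x \<F> \<inter> R_dir x) (N_fan \<F>))
     \<and>
     (dim (UNIV :: 'a set) = 2 \<longrightarrow>
      cone_of_norms (N_dir E) \<and>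
      blunt_cone (R_dir x) \<and>
      bij_betw (rho x) (R_dir x) (N_dir E) \<and>
      (\<forall>\<alpha>\<in>R_dir x. \<forall>\<beta>\<in>R_dir x. rho x (\<alpha> + \<beta>) = (\<lambda>y. rho x \<alpha> y + rho x \<beta> y)) \<and>
      (\<forall>\<alpha>\<in>R_dir x. \<forall>c>0. rho x (c *\<^sub>R \<alpha>) = (\<lambda>y. c * rho x \<alpha> y)))"
proof -
  interpret direction_fan E x \<F>
    using E x F(1,3,4) by unfold_locales
  have scale: "rho x (c *\<^sub>R \<alpha>) = (\<lambda>y. c * rho x \<alpha> y)" if "\<alpha> \<in> R_dir x" "c > 0" for \<alpha> c
    using rho_scale_weights[OF R_dirD(1)[OF that(1)] that(2)] by blast
  have all_rays: "bij_betw (rho x) (R_fan E x \<F>) (N_fan \<F>)" if "uses_all_rays E \<F>"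
    using bij_betw_rho_N_fan R_fan_subset_R_dir[OF that] by (simp add: Int_absorb2)
  show ?thesis
    by (intro conjI ballI allI impI scale scale[symmetric] all_rays N_dir_scale
        cone_of_norms_N_fan blunt_cone_R_fan rho_add_R_fan(2) rho_scale_R_fan rho_image_R_fan
        blunt_cone_R_fan_Int_R_dir bij_betw_rho_N_fan cone_of_norms_N_dir_planar
        blunt_cone_R_dir_planar bij_betw_rho_N_dir_planar rho_add_R_dir_planar)
qed

end
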